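(* In the finite-horizon Bayesian Bernoulli bandit with uniform prior and $\lfloor N/3\rfloor$ pulls per period, the optimality gap $V_N^*-V_N(\pi)$ is $\Omega(N)$ as $N\to\infty$ for both $\pi=\mathrm{UCB}$ and $\pi=\mathrm{TS}$ (Thompson Sampling), for horizon $T=15$ and for horizon $T=20$.
   Context: Bayesian Bernoulli bandit: there are $N$ arms and $T$ periods. Each arm $i$ has an unobserved parameter $\theta_i$, drawn independently from the uniform distribution on $[0,1]$. Conditionally on $\theta_i$, the rewards obtained each time arm $i$ is pulled are independent Bernoulli$(\theta_i)$ random variables, independent across arms. In each period, $\lfloor N/3\rfloor$ distinct arms are pulled, chosen on the basis of all rewards observed so far (the state of an arm is the posterior distribution of its $\theta_i$, a Beta distribution; an unpulled arm's state does not change). $V_N(\pi)$ is the expected total reward over the $T$ periods under policy $\pi$ (expectation also over the prior), and $V_N^*=\sup_\pi V_N(\pi)$ over all policies. UCB: in each period, for each arm $i$ compute $\mu_i+\delta\sigma_i$, where $\mu_i,\sigma_i$ are the mean and standard deviation of the current posterior of $\theta_i$ and $\delta=0.5$; pull the $\lfloor N/3\rfloor$ arms with the largest values. TS: in each period, sample independently a value from each arm's current posterior on $\theta_i$, and pull the $\lfloor N/3\rfloor$ arms with the largest sampled values. "$\Omega(N)$" means there is $c>0$ such that the gap is at least $cN$ for all sufficiently large $N$. *)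

theory Defs
  imports "HOL-Probability.Probability"
begin

(* A history lists, per period, the set of arms pulled and their outcomes; only the outcomes
   of pulled arms are meaningful (all others are set to False by Pi_pmf below). *)
type_synonym history = "(nat set \<times> (nat \<Rightarrow> bool)) list"

(* Behavioural strategies: the law of the next set of arms, given the history. *)
type_synonym policy = "history \<Rightarrow> nat set pmf"

definition selections :: "nat \<Rightarrow> nat set set" where
  "selections N = {S. S \<subseteq> {..<N} \<and> card S = N div 3}"

definition admissible :: "nat \<Rightarrow> policy \<Rightarrow> bool" where
  "admissible N \<pi> \<longleftrightarrow> (\<forall>h. set_pmf (\<pi> h) \<subseteq> selections N)"

primrec play :: "policy \<Rightarrow> (nat \<Rightarrow> real) \<Rightarrow> nat \<Rightarrow> history pmf" where
  "play \<pi> \<theta> 0 = return_pmf []"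
| "play \<pi> \<theta> (Suc t) =
     bind_pmf (play \<pi> \<theta> t) (\<lambda>h.
     bind_pmf (\<pi> h) (\<lambda>S.
     map_pmf (\<lambda>r. h @ [(S, r)]) (Pi_pmf S False (\<lambda>i. bernoulli_pmf (\<theta> i)))))"

definition total_reward :: "history \<Rightarrow> real" where
  "total_reward h = (\<Sum>(S, r)\<leftarrow>h. real (card {i \<in> S. r i}))"

definition prior :: "nat \<Rightarrow> (nat \<Rightarrow> real) measure" where
  "prior N = PiM {..<N} (\<lambda>_. uniform_measure lborel {0..1})"

definition policy_value :: "nat \<Rightarrow> nat \<Rightarrow> policy \<Rightarrow> real" where
  "policy_value T N \<pi> =
     (\<integral>\<theta>. measure_pmf.expectation (play \<pi> \<theta> T) total_reward \<partial>prior N)"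

definition optimal_value :: "nat \<Rightarrow> nat \<Rightarrow> real" where
  "optimal_value T N = (SUP \<pi> \<in> {\<pi>. admissible N \<pi>}. policy_value T N \<pi>)"

definition successes :: "history \<Rightarrow> nat \<Rightarrow> nat" where
  "successes h i = length (filter (\<lambda>(S, r). i \<in> S \<and> r i) h)"

definition failures :: "history \<Rightarrow> nat \<Rightarrow> nat" where
  "failures h i = length (filter (\<lambda>(S, r). i \<in> S \<and> \<not> r i) h)"

(* The Beta(s + 1, f + 1) distribution *)
definition beta_measure :: "nat \<Rightarrow> nat \<Rightarrow> real measure" where
  "beta_measure s f = density lborel
     (\<lambda>x. ennreal (indicator {0..1} x * (x ^ s * (1 - x) ^ f) / Beta (real s + 1) (real f + 1)))"

definition posterior :: "history \<Rightarrow> nat \<Rightarrow> real measure" where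
  "posterior h i = beta_measure (successes h i) (failures h i)"

definition mean_of :: "real measure \<Rightarrow> real" where
  "mean_of M = (\<integral>x. x \<partial>M)"

definition sd_of :: "real measure \<Rightarrow> real" where
  "sd_of M = sqrt (\<integral>x. (x - mean_of M)\<^sup>2 \<partial>M)"

definition top_selection :: "nat \<Rightarrow> (nat \<Rightarrow> real) \<Rightarrow> nat set \<Rightarrow> bool" where
  "top_selection N v S \<longleftrightarrow>
     S \<in> selections N \<and> (\<forall>i \<in> S. \<forall>j \<in> {..<N} - S. v j \<le> v i)"

definition ucb_index :: "history \<Rightarrow> nat \<Rightarrow> real" where
  "ucb_index h i = mean_of (posterior h i) + 1/2 * sd_of (posterior h i)"

(* Ties between equal indices may be broken in any way, also at random. *)
definition is_ucb :: "nat \<Rightarrow> policy \<Rightarrow> bool" where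
  "is_ucb N \<pi> \<longleftrightarrow> (\<forall>h. \<forall>S \<in> set_pmf (\<pi> h). top_selection N (ucb_index h) S)"

(* Ties between sampled values are null events, so the numbers below sum to 1
   (see pmf_thompson). *)
definition thompson :: "nat \<Rightarrow> policy" where
  "thompson N h = embed_pmf (\<lambda>S. measure (PiM {..<N} (posterior h))
     {x \<in> space (PiM {..<N} (posterior h)). top_selection N x S})"


lemma nn_integral_beta_kernel:
  "(\<integral>\<^sup>+x. ennreal (indicator {0..1} x * (x ^ s * (1 - x) ^ f)) \<partial>lborel)
     = ennreal (Beta (real s + 1) (real f + 1))"
proof -
  have "((\<lambda>t. t powr (real s + 1 - 1) * (1 - t) powr (real f + 1 - 1)) has_integral
           Beta (real s + 1) (real f + 1)) {0..1}"
    by (rule has_integral_Beta_real) auto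
  then have "((\<lambda>t::real. t ^ s * (1 - t) ^ f) has_integral Beta (real s + 1) (real f + 1)) {0..1}"
    by (rule has_integral_spike_finite[of "{0, 1}", rotated 2]) (auto simp: powr_realpow)
  then have "((\<lambda>x. indicator {0..1} x * (x ^ s * (1 - x) ^ f)) has_integral
      Beta (real s + 1) (real f + 1)) UNIV"
    by (subst (asm) has_integral_restrict_UNIV[symmetric])
       (erule has_integral_eq[rotated], auto simp: indicator_def)
  then show ?thesis
    by (intro nn_integral_has_integral_lborel) (auto simp: indicator_def)
qed

lemma Beta_nat_pos: "Beta (real s + 1) (real f + 1) > 0"
  by (auto simp: Beta_def intro!: divide_pos_pos mult_pos_pos Gamma_real_pos)

lemma sets_beta_measure [simp, measurable_cong]: "sets (beta_measure s f) = sets borel"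
  and space_beta_measure [simp]: "space (beta_measure s f) = UNIV"
  by (simp_all add: beta_measure_def)

lemma prob_space_beta_measure: "prob_space (beta_measure s f)"
proof
  let ?B = "Beta (real s + 1) (real f + 1)"
  have "emeasure (beta_measure s f) (space (beta_measure s f)) =
     (\<integral>\<^sup>+x. ennreal (indicator {0..1} x * (x ^ s * (1 - x) ^ f) / ?B) \<partial>lborel)"
    by (simp add: beta_measure_def emeasure_density)
  also have "\<dots> = (\<integral>\<^sup>+x. ennreal (indicator {0..1} x * (x ^ s * (1 - x) ^ f)) / ennreal ?B \<partial>lborel)"
    by (intro nn_integral_cong divide_ennreal[symmetric]) (auto simp: indicator_def Beta_nat_pos)
  also have "\<dots> = ennreal ?B / ennreal ?B"
    by (subst nn_integral_divide) (auto simp: nn_integral_beta_kernel)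
  also have "\<dots> = 1"
    using Beta_nat_pos[of s f] by (intro ennreal_divide_self) auto
  finally show "emeasure (beta_measure s f) (space (beta_measure s f)) = 1" .
qed

(* Bayes' rule: the posterior density with respect to the uniform prior is the likelihood of
   the outcomes of the arm, normalised. *)
lemma posterior_bayes:
  defines "L \<equiv> \<lambda>h i x. \<Prod>(S, r)\<leftarrow>h. if i \<in> S then pmf (bernoulli_pmf x) (r i) else 1"
  shows "posterior h i = density (uniform_measure lborel {0..1})
     (\<lambda>x. ennreal (L h i x) / (\<integral>\<^sup>+y. ennreal (L h i y) \<partial>uniform_measure lborel {0..1}))"
proof -
  have L: "L h i x = x ^ successes h i * (1 - x) ^ failures h i" if "x \<in> {0..1}" for x
    using that unfolding L_def successes_def failures_def
    by (induction h) auto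
  have U: "uniform_measure lborel {0..1::real} = density lborel (indicator {0..1})"
    by (auto simp: uniform_measure_def indicator_def intro!: density_cong)
  have [measurable]: "(\<lambda>x. ennreal (L h i x)) \<in> borel_measurable borel"
  proof -
    have "(\<lambda>x. L h i x) \<in> borel_measurable borel"
      unfolding L_def
    proof (induction h)
      case (Cons a h)
      have "(\<lambda>x. pmf (bernoulli_pmf x) b) = (\<lambda>x. if b then max 0 (min 1 x) else 1 - max 0 (min 1 x))" for b
        by (auto simp: fun_eq_iff bernoulli_pmf.rep_eq) 
      then have "(\<lambda>x. pmf (bernoulli_pmf x) b) \<in> borel_measurable borel" for b
        by (cases b) simp_all
      with Cons show ?case by (cases a) auto
    qed simp
    then show ?thesis by measurable
  qed
  have Z: "(\<integral>\<^sup>+y. ennreal (L h i y) \<partial>uniform_measure lborel {0..1})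
      = ennreal (Beta (real (successes h i) + 1) (real (failures h i) + 1))"
    unfolding U nn_integral_beta_kernel[symmetric]
    by (subst nn_integral_density) (auto intro!: nn_integral_cong simp: L indicator_def)
  show ?thesis
    unfolding posterior_def beta_measure_def Z unfolding U
    by (subst density_density_eq)
       (auto intro!: density_cong AE_I2 simp: L indicator_def divide_ennreal Beta_nat_pos)
qed

lemma finite_selections: "finite (selections N)"
  by (simp add: selections_def)

lemma ex_top_selection: "\<exists>S. top_selection N v S"
proof -
  have "\<exists>S \<subseteq> {..<N}. card S = k \<and> (\<forall>i \<in> S. \<forall>j \<in> {..<N} - S. v j \<le> v i)" if "k \<le> N" for k
    using that
  proof (induction k)
    case (Suc k)
    then obtain S where S: "S \<subseteq> {..<N}" "card S = k" "\<forall>i \<in> S. \<forall>j \<in> {..<N} - S. v j \<le> v i"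
      by auto
    then have "{..<N} - S \<noteq> {}"
      using Suc.prems by (metis Diff_eq_empty_iff card_lessThan card_mono finite_subset finite_lessThan not_less_eq_eq)
    then obtain m where m: "m \<in> {..<N} - S" "\<forall>j \<in> {..<N} - S. v j \<le> v m"
      using Max_in[of "v ` ({..<N} - S)"] Max_ge[of "v ` ({..<N} - S)"] by fastforce
    then have "card (insert m S) = Suc k"
      using S by (auto simp: finite_subset)
    then show ?case
      using S m by (intro exI[of _ "insert m S"]) auto
  qed auto
  from this[of "N div 3"] show ?thesis
    by (auto simp: top_selection_def selections_def)
qed

lemma ex_is_ucb: "\<exists>\<pi>. is_ucb N \<pi>"
  by (rule exI[of _ "\<lambda>h. return_pmf (SOME S. top_selection N (ucb_index h) S)"])
     (auto simp: is_ucb_def intro: someI_ex[OF ex_top_selection])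

lemma is_ucb_imp_admissible: "is_ucb N \<pi> \<Longrightarrow> admissible N \<pi>"
  by (auto simp: is_ucb_def admissible_def top_selection_def)

lemma top_selection_unique:
  assumes "top_selection N v S" "top_selection N v S'" "inj_on v {..<N}"
  shows "S = S'"
proof (rule ccontr)
  assume "S \<noteq> S'"
  have fin: "finite S" "finite S'" and sub: "S \<subseteq> {..<N}" "S' \<subseteq> {..<N}" and "card S = card S'"
    using assms by (auto simp: top_selection_def selections_def finite_subset)
  with \<open>S \<noteq> S'\<close> have "\<not> S \<subseteq> S'" "\<not> S' \<subseteq> S"
    by (metis card_subset_eq)+
  then obtain i j where ij: "i \<in> S" "i \<notin> S'" "j \<in> S'" "j \<notin> S" by auto
  then have "v i = v j"
    using assms(1,2) sub unfolding top_selection_def by (meson Diff_iff antisym subsetD)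
  then show False
    using ij sub assms(3) by (auto simp: inj_on_def)
qed

lemma AE_PiM_beta_no_ties:
  fixes I :: "nat set"
  assumes "finite I" "i \<in> I" "j \<in> I" "i \<noteq> j"
  shows "AE x in PiM I (\<lambda>k. beta_measure (s k) (f k)). x i \<noteq> x j"
proof -
  let ?M = "\<lambda>k. beta_measure (s k) (f k)"
  interpret product_prob_space ?M
    by (intro product_prob_spaceI prob_space_beta_measure)
  define J where "J = I - {i}"
  have J: "finite J" "i \<notin> J" "j \<in> J" "I = insert i J"
    using assms by (auto simp: J_def)
  have comp: "(\<lambda>x. x k) \<in> borel_measurable (PiM I ?M)" if "k \<in> I" for k
    using measurable_component_singleton[OF that, of ?M]
    unfolding measurable_cong_sets[OF refl sets_beta_measure] .
  have [measurable]: "Measurable.pred (PiM I ?M) (\<lambda>x. x i = x j)"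
    unfolding pred_def by (rule borel_measurable_eq[OF comp[OF assms(2)] comp[OF assms(3)]])
  have point: "emeasure (?M i) {c} = 0" for c
    by (simp add: beta_measure_def emeasure_density)
  define F :: "(nat \<Rightarrow> real) \<Rightarrow> ennreal" where "F = (\<lambda>x. if x i = x j then 1 else 0)"
  have F [measurable]: "F \<in> borel_measurable (PiM I ?M)"
    unfolding F_def by measurable
  have "(\<integral>\<^sup>+x. F x \<partial>PiM (insert i J) ?M) =
      (\<integral>\<^sup>+x. (\<integral>\<^sup>+y. F (x(i := y)) \<partial>?M i) \<partial>PiM J ?M)"
    using F J by (intro product_nn_integral_insert) simp_all
  also have "\<dots> = (\<integral>\<^sup>+x. (\<integral>\<^sup>+y. indicator {x j} y \<partial>?M i) \<partial>PiM J ?M)"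
    using assms(4) by (intro nn_integral_cong) (auto simp: F_def indicator_def)
  also have "\<dots> = 0"
    by (simp add: point)
  finally have "(\<integral>\<^sup>+x. F x \<partial>PiM I ?M) = 0"
    by (simp only: J(4))
  then have "AE x in PiM I ?M. F x = 0"
    by (simp add: nn_integral_0_iff_AE)
  then show ?thesis
    by eventually_elim (auto simp: F_def split: if_splits)
qed

lemma pmf_thompson:
  "pmf (thompson N h) S = measure (PiM {..<N} (posterior h))
     {x \<in> space (PiM {..<N} (posterior h)). top_selection N x S}"
proof -
  let ?P = "PiM {..<N} (posterior h)"
  let ?E = "\<lambda>S. {x \<in> space ?P. top_selection N x S}"
  interpret prob_space ?P
    by (intro prob_space_PiM) (simp add: posterior_def prob_space_beta_measure)
  have [measurable_cong]: "sets (posterior h i) = sets borel" for i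
    by (simp add: posterior_def)
  have comp: "(\<lambda>x. x k) \<in> borel_measurable ?P" if "k < N" for k
    using measurable_component_singleton[of k "{..<N}" "posterior h"] that
    unfolding posterior_def measurable_cong_sets[OF refl sets_beta_measure] by simp
  have le: "Measurable.pred ?P (\<lambda>x. x j \<le> x i)" if "i < N" "j < N" for i j
    unfolding pred_def by (rule borel_measurable_le[OF comp[OF that(2)] comp[OF that(1)]])
  have E: "?E S \<in> sets ?P" for S
  proof (cases "S \<in> selections N")
    case True
    then have "Measurable.pred ?P (\<lambda>x. \<forall>i \<in> S. \<forall>j \<in> {..<N} - S. x j \<le> x i)"
      by (intro pred_intros_finite le)
         (auto simp: selections_def intro: finite_subset)
    with True show ?thesis
      by (simp add: top_selection_def pred_def)
  qed (simp add: top_selection_def)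
  have "AE x in ?P. inj_on x {..<N}"
  proof -
    have "AE x in ?P. \<forall>i \<in> {..<N}. \<forall>j \<in> {..<N} - {i}. x i \<noteq> x j"
      unfolding posterior_def
      by (intro AE_finite_allI AE_PiM_beta_no_ties) auto
    then show ?thesis
      by eventually_elim (auto simp: inj_on_def)
  qed
  then have "AE x in ?P. (\<Sum>S\<in>selections N. indicator (?E S) x) = (1::ennreal)"
    using AE_space
  proof eventually_elim
    case (elim x)
    obtain S where S: "top_selection N x S" using ex_top_selection by blast
    have "indicator (?E S') x = (if S' = S then 1 else 0 :: ennreal)" for S'
      using S top_selection_unique[OF _ S elim(1), of S'] elim(2) by (cases "S' = S") (auto simp: indicator_def)
    moreover have "S \<in> selections N"
      using S by (simp add: top_selection_def)
    ultimately show ?case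
      by (simp add: finite_selections)
  qed
  then have "1 = (\<integral>\<^sup>+x. (\<Sum>S\<in>selections N. indicator (?E S) x) \<partial>?P)"
    by (subst nn_integral_cong_AE[where v = "\<lambda>_. 1"]) (auto simp: emeasure_space_1)
  also have "\<dots> = (\<Sum>S\<in>selections N. emeasure ?P (?E S))"
    using E by (subst nn_integral_sum) auto
  also have "\<dots> = (\<integral>\<^sup>+S. ennreal (prob (?E S)) \<partial>count_space UNIV)"
  proof -
    have "prob (?E S) = 0" if "S \<notin> selections N" for S
      using that by (simp add: top_selection_def)
    then have "(\<integral>\<^sup>+S. ennreal (prob (?E S)) \<partial>count_space UNIV)
        = (\<Sum>S\<in>selections N. ennreal (prob (?E S)))"
      by (intro nn_integral_count_space'[OF finite_selections]) auto
    then show ?thesis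
      by (simp only: emeasure_eq_measure)
  qed
  finally show ?thesis
    unfolding thompson_def by (subst pmf_embed_pmf) auto
qed

lemma admissible_thompson: "admissible N (thompson N)"
  unfolding admissible_def
proof (intro allI subsetI)
  fix h S
  assume "S \<in> set_pmf (thompson N h)"
  then have "pmf (thompson N h) S \<noteq> 0"
    by (simp only: set_pmf_iff not_False_eq_True)
  then show "S \<in> selections N"
    unfolding pmf_thompson by (cases "S \<in> selections N") (simp_all add: top_selection_def)
qed

end

theory Submission
  imports Defs
begin

text \<open>
  Both rules already lose a constant amount per arm in the very last period. There nothing is left
  to learn, so the best selection consists of the arms with the largest posterior means; and
  following a policy until the last period and then selecting in this way is again a policy. Hence
  the optimality gap is at least the expected regret of the last period, the amount by which the
  posterior means of the pulled arms fall short of the largest possible ones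
  (\<open>optimality_gap_ge_regret\<close>). To bound it from below by a multiple of \<open>N\<close>, it suffices to
  exhibit linearly many disjoint pairs of arms of which the one with the smaller posterior mean is
  pulled and the other one is not (\<open>regret_ge_exchange\<close>). All expectations are taken after
  integrating the parameters out: under the marginal law of the history, a pulled arm succeeds with
  its current posterior mean (\<open>policy_value_predictive\<close>).

  Thompson sampling. The densities of the finitely many posteriors that can occur are bounded, and
  they charge every neighbourhood of 0 and of 1. So for every history and every ordered pair of
  arms \<open>i\<close>, \<open>j\<close>, with probability bounded away from 0, the sample of \<open>i\<close> is close to 1, that of
  \<open>j\<close> is close to 0, and fewer than \<open>N div 3\<close> (respectively \<open>N - N div 3\<close>) of the other samples are so
  extreme, whence \<open>i\<close> is pulled and \<open>j\<close> is not (\<open>thompson_separates_pairs\<close>). Used in the last but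
  one period, this makes the posterior means of any two arms differ with probability bounded away
  from 0, because the outcome of the pull moves the mean of \<open>i\<close> to one of two different values. Used
  in the last period, it makes the worse arm of such a pair be pulled instead of the better one.
  The pairs \<open>2 * k\<close>, \<open>2 * k + 1\<close> are linearly many.

  UCB. The state of an arm is its pair of numbers of successes and failures. Given the number of
  arms in each state, the rule determines up to ties between equal indices how many arms of each
  state are pulled, and the outcomes move the numbers by their means up to fluctuations of order
  \<open>sqrt N\<close>. Thus, whichever way ties are broken, the numbers stay within expected distance
  \<open>O(sqrt N)\<close> of \<open>N\<close> times a deterministic fluid profile (\<open>ucb_converges_to_fluid\<close>). If the fluid
  profile contains a state that is pulled and another state that is not completely pulled although
  its mean is larger, then the last-period regret is linear (\<open>ucb_gap_linear\<close>). Whether such a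
  pair exists depends on the horizon, so the profiles are computed exactly (\<open>run_periods\<close>). In
  period 15, arms with one success and one failure (mean 1/2) are pulled, and a positive fraction
  of arms with seven successes and six failures (mean 8/15) is not; in period 20, the same happens
  for two successes and two failures (mean 1/2) against nine successes and eight failures (mean
  10/19). In both cases the better arms have a smaller standard deviation and hence a smaller index.
\<close>

section \<open>Moments of the posterior distributions\<close>

lemma Beta_nat: "Beta (real s + 1) (real f + 1) = fact s * fact f / fact (s + f + 1)"
proof -
  have "Gamma (real s + 1) = fact s" "Gamma (real f + 1) = fact f"
    using Gamma_fact[of s, where 'a = real] Gamma_fact[of f, where 'a = real]
    by (simp_all add: add.commute)
  moreover have "Gamma (real s + 1 + (real f + 1)) = fact (s + f + 1)"
    using Gamma_fact[of "s + f + 1", where 'a = real] by (simp add: algebra_simps)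
  ultimately show ?thesis
    by (simp add: Beta_def)
qed

text \<open>
  The probability, under the uniform prior, of one particular sequence of outcomes of an arm with
  \<open>fst a\<close> successes and \<open>snd a\<close> failures. It equals the normalising constant of the posterior.
\<close>
definition sequence_prob :: "nat \<times> nat \<Rightarrow> real" where
  "sequence_prob a = fact (fst a) * fact (snd a) / fact (fst a + snd a + 1)"

definition state_mean :: "nat \<times> nat \<Rightarrow> real" where
  "state_mean a = (real (fst a) + 1) / (real (fst a) + real (snd a) + 2)"

abbreviation state :: "history \<Rightarrow> nat \<Rightarrow> nat \<times> nat" where
  "state h i \<equiv> (successes h i, failures h i)"

lemma sequence_prob_pos: "0 < sequence_prob a"
  by (simp add: sequence_prob_def)

lemma state_mean_bounds: "0 < state_mean a" "state_mean a < 1"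
  by (simp_all add: state_mean_def field_simps add_pos_nonneg)

lemma sequence_prob_Suc:
  "sequence_prob (Suc s, f) = sequence_prob (s, f) * state_mean (s, f)"
  "sequence_prob (s, Suc f) = sequence_prob (s, f) * (1 - state_mean (s, f))"
proof -
  have "real s + real f + 2 \<noteq> 0" "(1 + real s + real f) \<noteq> 0"
    by linarith+
  then show "sequence_prob (Suc s, f) = sequence_prob (s, f) * state_mean (s, f)"
    "sequence_prob (s, Suc f) = sequence_prob (s, f) * (1 - state_mean (s, f))"
    by (simp_all add: sequence_prob_def state_mean_def field_simps)
qed

lemma sequence_prob_eq_Beta: "sequence_prob (s, f) = Beta (real s + 1) (real f + 1)"
  by (simp only: Beta_nat sequence_prob_def fst_conv snd_conv)

lemma has_bochner_integral_beta_measure: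
  "has_bochner_integral (beta_measure s f) (\<lambda>x. x ^ j * (1 - x) ^ k)
     (sequence_prob (s + j, f + k) / sequence_prob (s, f))"
proof -
  let ?B = "Beta (real s + 1) (real f + 1)"
  have "has_bochner_integral lborel (\<lambda>x. indicator {0..1} x * (x ^ (s + j) * (1 - x) ^ (f + k)))
     (sequence_prob (s + j, f + k))"
    using nn_integral_beta_kernel[of "s + j" "f + k"] sequence_prob_pos[of "(s + j, f + k)"]
    unfolding sequence_prob_eq_Beta[symmetric]
    by (intro has_bochner_integral_nn_integral) (auto simp: indicator_def)
  then have "has_bochner_integral lborel
     (\<lambda>x. indicator {0..1} x * (x ^ (s + j) * (1 - x) ^ (f + k)) / ?B)
     (sequence_prob (s + j, f + k) / ?B)"
    by (rule has_bochner_integral_divide_zero)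
  then have "has_bochner_integral lborel
     (\<lambda>x. (indicator {0..1} x * (x ^ s * (1 - x) ^ f) / ?B) *\<^sub>R (x ^ j * (1 - x) ^ k))
     (sequence_prob (s + j, f + k) / ?B)"
    by (simp add: power_add mult_ac)
  then show ?thesis
    unfolding beta_measure_def sequence_prob_eq_Beta[of s f]
    using Beta_nat_pos[of s f]
    by (intro has_bochner_integral_density) (auto simp: indicator_def)
qed

lemma integral_beta_measure:
  "(\<integral>x. x ^ j * (1 - x) ^ k \<partial>beta_measure s f) = sequence_prob (s + j, f + k) / sequence_prob (s, f)"
  by (rule has_bochner_integral_integral_eq[OF has_bochner_integral_beta_measure])

lemma mean_of_beta_measure: "mean_of (beta_measure s f) = state_mean (s, f)"
  using integral_beta_measure[of s f 1 0] sequence_prob_pos[of "(s, f)"]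
  by (simp add: mean_of_def sequence_prob_Suc)

lemma sd_of_beta_measure:
  fixes s f :: nat
  defines "m \<equiv> state_mean (s, f)"
  shows "sd_of (beta_measure s f) = sqrt (m * (1 - m) / (real s + real f + 3))"
proof -
  interpret prob_space "beta_measure s f" by (rule prob_space_beta_measure)
  have i: "integrable (beta_measure s f) (\<lambda>x. x ^ j * (1 - x) ^ k)" for j k
    by (rule integrable.intros[OF has_bochner_integral_beta_measure])
  have i1: "integrable (beta_measure s f) (\<lambda>x. x)" and i2: "integrable (beta_measure s f) power2"
    using i[of 1 0] i[of 2 0] by simp_all
  have "(\<integral>x. (x - m)\<^sup>2 \<partial>beta_measure s f) = (\<integral>x. x\<^sup>2 \<partial>beta_measure s f) - m\<^sup>2"
    using variance_eq[OF i1 i2] mean_of_beta_measure[of s f] by (simp add: mean_of_def m_def)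
  also have "(\<integral>x. x\<^sup>2 \<partial>beta_measure s f) = state_mean (s, f) * state_mean (Suc s, f)"
    using integral_beta_measure[of s f 2 0] sequence_prob_pos[of "(s, f)"]
    by (simp add: sequence_prob_Suc numeral_2_eq_2)
  also have "\<dots> - m\<^sup>2 = m * (1 - m) / (real s + real f + 3)"
  proof -
    have "real s + real f + 2 \<noteq> 0" "real s + real f + 3 \<noteq> 0" by linarith+
    moreover have "1 + real s + real f + 2 = real s + real f + 3" by simp
    ultimately show ?thesis
      unfolding m_def state_mean_def power2_eq_square
      by (simp add: divide_simps) (simp add: algebra_simps)
  qed
  finally show ?thesis
    unfolding sd_of_def mean_of_beta_measure m_def by simp
qed

section \<open>The marginal law of the history\<close>

text \<open>
  The process \<open>play\<close> with the unknown parameters replaced by the current posterior means. That this is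
  its law after integration over the prior is the content of \<open>policy_value_predictive\<close>.
\<close>
primrec predictive :: "policy \<Rightarrow> nat \<Rightarrow> history pmf" where
  "predictive \<pi> 0 = return_pmf []"
| "predictive \<pi> (Suc t) =
     bind_pmf (predictive \<pi> t) (\<lambda>h.
     bind_pmf (\<pi> h) (\<lambda>S.
     map_pmf (\<lambda>r. h @ [(S, r)]) (Pi_pmf S False (\<lambda>i. bernoulli_pmf (state_mean (state h i))))))"

text \<open>
  The finite set that supports \<open>play\<close> and \<open>predictive\<close>; outcomes of arms that were not pulled carry the
  default value \<open>False\<close>.
\<close>
definition histories :: "nat \<Rightarrow> nat \<Rightarrow> history set" where
  "histories N t = {h. length h = t \<and>
     (\<forall>(S, r) \<in> set h. S \<in> selections N \<and> (\<forall>i. i \<notin> S \<longrightarrow> \<not> r i))}"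

lemma finite_selection: "S \<in> selections N \<Longrightarrow> finite S"
  by (auto simp: selections_def intro: finite_subset)

lemma finite_histories: "finite (histories N t)"
proof -
  let ?E = "selections N \<times> Pow {..<N}"
  have "histories N t \<subseteq> map (\<lambda>(S, A). (S, \<lambda>i. i \<in> A)) ` {xs. set xs \<subseteq> ?E \<and> length xs = t}"
  proof
    fix h assume h: "h \<in> histories N t"
    have "h = map (\<lambda>(S, A). (S, \<lambda>i. i \<in> A)) (map (\<lambda>(S, r). (S, Collect r)) h)"
      by (induction h) auto
    moreover have "set (map (\<lambda>(S, r). (S, Collect r)) h) \<subseteq> ?E"
      using h by (fastforce simp: histories_def selections_def)
    moreover have "length (map (\<lambda>(S, r). (S, Collect r)) h) = t"
      using h by (simp add: histories_def)
    ultimately show "h \<in> map (\<lambda>(S, A). (S, \<lambda>i. i \<in> A)) ` {xs. set xs \<subseteq> ?E \<and> length xs = t}"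
      by (metis (mono_tags, lifting) image_eqI mem_Collect_eq)
  qed
  moreover have "finite {xs. set xs \<subseteq> ?E \<and> length xs = t}"
    by (intro finite_lists_length_eq) (simp add: finite_selections)
  ultimately show ?thesis
    by (meson finite_imageI finite_subset)
qed

lemma histories_0: "histories N 0 = {[]}"
  by (auto simp: histories_def)

lemma states_le_length: "successes h i + failures h i \<le> length h"
  unfolding successes_def failures_def by (induction h) auto

lemma state_sum_le: "h \<in> histories N t \<Longrightarrow> successes h i + failures h i \<le> t"
  using states_le_length[of h i] by (simp add: histories_def)

lemma snoc_in_histories:
  "h @ [(S, r)] \<in> histories N (Suc t) \<longleftrightarrow>
     h \<in> histories N t \<and> S \<in> selections N \<and> (\<forall>i. i \<notin> S \<longrightarrow> \<not> r i)"
  by (auto simp: histories_def)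

lemma histories_SucE:
  assumes "h \<in> histories N (Suc t)"
  obtains h' S r where "h = h' @ [(S, r)]" "h' \<in> histories N t" "S \<in> selections N"
    "\<And>i. i \<notin> S \<Longrightarrow> \<not> r i"
proof -
  have "h \<noteq> []" using assms by (auto simp: histories_def)
  then obtain h' S r where "h = h' @ [(S, r)]" by (metis rev_exhaust surj_pair)
  with assms that show ?thesis by (simp add: snoc_in_histories)
qed

lemma finite_Pi_pmf_bool: "finite S \<Longrightarrow> finite (set_pmf (Pi_pmf S False (p :: _ \<Rightarrow> bool pmf)))"
  by (rule finite_subset[OF set_Pi_pmf_subset']) auto

lemma set_pmf_policy: "admissible N \<pi> \<Longrightarrow> set_pmf (\<pi> h) \<subseteq> selections N"
  by (simp add: admissible_def)

lemma finite_policy: "admissible N \<pi> \<Longrightarrow> finite (set_pmf (\<pi> h))"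
  using finite_subset[OF set_pmf_policy finite_selections] .

lemma set_pmf_play: "admissible N \<pi> \<Longrightarrow> set_pmf (play \<pi> \<theta> t) \<subseteq> histories N t"
proof (induction t)
  case (Suc t)
  show ?case
    using Suc set_pmf_policy[OF Suc.prems] finite_selection set_Pi_pmf_subset
    by (fastforce simp: snoc_in_histories)
qed (simp add: histories_0)

lemma set_pmf_predictive: "admissible N \<pi> \<Longrightarrow> set_pmf (predictive \<pi> t) \<subseteq> histories N t"
proof (induction t)
  case (Suc t)
  show ?case
    using Suc set_pmf_policy[OF Suc.prems] finite_selection set_Pi_pmf_subset
    by (fastforce simp: snoc_in_histories)
qed (simp add: histories_0)

lemma finite_predictive: "admissible N \<pi> \<Longrightarrow> finite (set_pmf (predictive \<pi> t))"
  using finite_subset[OF set_pmf_predictive finite_histories] .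

text \<open>
  Both processes extend a history by a selection and outcomes, which can be read off from the longer
  history; so their point masses multiply.
\<close>
lemma pmf_bind_snoc:
  "pmf (bind_pmf P (\<lambda>h. bind_pmf (Q h) (\<lambda>S. map_pmf (\<lambda>r. h @ [(S, r)]) (R h S)))) (h @ [(S, r)])
   = pmf P h * pmf (Q h) S * pmf (R h S) r"
proof -
  have R: "pmf (map_pmf (\<lambda>r. h' @ [(S', r)]) (R h' S')) (h @ [(S, r)])
      = indicator {h} h' * (indicator {S} S' * pmf (R h S) r)" for h' S'
  proof (cases "h' = h \<and> S' = S")
    case True
    then show ?thesis
      using pmf_map_inj'[of "\<lambda>r. h @ [(S, r)]" "R h S" r] by (simp add: inj_def)
  next
    case False
    then have "h @ [(S, r)] \<notin> set_pmf (map_pmf (\<lambda>r. h' @ [(S', r)]) (R h' S'))"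
      by auto
    with False show ?thesis
      by (auto simp: pmf_eq_0_set_pmf)
  qed
  have "pmf (bind_pmf (Q h') (\<lambda>S'. map_pmf (\<lambda>r. h' @ [(S', r)]) (R h' S'))) (h @ [(S, r)])
      = indicator {h} h' * (pmf (Q h) S * pmf (R h S) r)" for h'
    unfolding pmf_bind R by (cases "h' = h") (simp_all add: measure_pmf_single)
  then show ?thesis
    by (subst pmf_bind) (simp add: measure_pmf_single)
qed

text \<open>
  The contribution of the policy to the probability of a history. It is the same for all parameters
  and for the marginal process, which is why it can be taken out of the integral over the prior.
\<close>
definition policy_factor :: "policy \<Rightarrow> history \<Rightarrow> real" where
  "policy_factor \<pi> h = (\<Prod>k<length h. pmf (\<pi> (take k h)) (fst (h ! k)))"

lemma policy_factor_snoc: "policy_factor \<pi> (h @ [(S, r)]) = policy_factor \<pi> h * pmf (\<pi> h) S"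
  by (simp add: policy_factor_def nth_append)

lemma state_snoc:
  "successes (h @ [(S, r)]) i = successes h i + of_bool (i \<in> S \<and> r i)"
  "failures (h @ [(S, r)]) i = failures h i + of_bool (i \<in> S \<and> \<not> r i)"
  by (simp_all add: successes_def failures_def)

text \<open>
  The common step of the next two inductions: only pulled arms change their state, so a product over
  all arms picks up one factor for each of them.
\<close>
lemma prod_arms_snoc:
  fixes g :: "nat \<Rightarrow> nat \<times> nat \<Rightarrow> real"
  assumes "S \<in> selections N"
    and "\<And>i. i \<in> S \<Longrightarrow> g i (state (h @ [(S, r)]) i) = g i (state h i) * c i"
  shows "(\<Prod>i<N. g i (state (h @ [(S, r)]) i)) = (\<Prod>i<N. g i (state h i)) * (\<Prod>i\<in>S. c i)"
proof -
  have S: "S \<subseteq> {..<N}" using assms(1) by (simp add: selections_def)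
  have "(\<Prod>i<N. g i (state (h @ [(S, r)]) i)) = (\<Prod>i<N. g i (state h i) * (if i \<in> S then c i else 1))"
    using assms(2) by (intro prod.cong) (auto simp: state_snoc)
  also have "(\<Prod>i<N. if i \<in> S then c i else 1) = (\<Prod>i\<in>S. c i)"
    using S by (simp add: prod.If_cases Int_absorb1)
  ultimately show ?thesis
    by (simp add: prod.distrib)
qed

lemma pmf_play:
  assumes "h \<in> histories N t"
  shows "pmf (play \<pi> \<theta> t) h = policy_factor \<pi> h *
    (\<Prod>i<N. pmf (bernoulli_pmf (\<theta> i)) True ^ successes h i * pmf (bernoulli_pmf (\<theta> i)) False ^ failures h i)"
  using assms
proof (induction t arbitrary: h)
  case 0
  then show ?case by (simp add: histories_0 policy_factor_def successes_def failures_def)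
next
  case (Suc t)
  from Suc.prems show ?case
  proof (cases rule: histories_SucE)
    case (1 h' S r)
    let ?g = "\<lambda>i a. pmf (bernoulli_pmf (\<theta> i)) True ^ fst a * pmf (bernoulli_pmf (\<theta> i)) False ^ snd a"
    have "pmf (Pi_pmf S False (\<lambda>i. bernoulli_pmf (\<theta> i))) r = (\<Prod>i\<in>S. pmf (bernoulli_pmf (\<theta> i)) (r i))"
      using 1 finite_selection by (intro pmf_Pi') auto
    moreover have "(\<Prod>i<N. ?g i (state (h' @ [(S, r)]) i))
        = (\<Prod>i<N. ?g i (state h' i)) * (\<Prod>i\<in>S. pmf (bernoulli_pmf (\<theta> i)) (r i))"
      using 1 by (intro prod_arms_snoc) (auto simp: state_snoc)
    ultimately show ?thesis
      unfolding 1 using Suc.IH[OF 1(2)] by (simp add: pmf_bind_snoc policy_factor_snoc)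
  qed
qed

lemma pmf_predictive:
  assumes "h \<in> histories N t"
  shows "pmf (predictive \<pi> t) h = policy_factor \<pi> h * (\<Prod>i<N. sequence_prob (state h i))"
  using assms
proof (induction t arbitrary: h)
  case 0
  then show ?case
    by (simp add: histories_0 policy_factor_def successes_def failures_def sequence_prob_def)
next
  case (Suc t)
  from Suc.prems show ?case
  proof (cases rule: histories_SucE)
    case (1 h' S r)
    let ?p = "\<lambda>i. bernoulli_pmf (state_mean (state h' i))"
    have "pmf (Pi_pmf S False ?p) r = (\<Prod>i\<in>S. pmf (?p i) (r i))"
      using 1 finite_selection by (intro pmf_Pi') auto
    moreover have "(\<Prod>i<N. sequence_prob (state (h' @ [(S, r)]) i))
        = (\<Prod>i<N. sequence_prob (state h' i)) * (\<Prod>i\<in>S. pmf (?p i) (r i))"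
    proof (rule prod_arms_snoc[OF 1(3)])
      fix i assume "i \<in> S"
      then show "sequence_prob (state (h' @ [(S, r)]) i) = sequence_prob (state h' i) * pmf (?p i) (r i)"
        using state_mean_bounds[of "state h' i"] sequence_prob_Suc[of "successes h' i" "failures h' i"]
        by (cases "r i") (auto simp: state_snoc)
    qed
    ultimately show ?thesis
      unfolding 1 using Suc.IH[OF 1(2)] by (simp add: pmf_bind_snoc policy_factor_snoc)
  qed
qed

lemma uniform_measure_eq_beta: "uniform_measure lborel {0..1::real} = beta_measure 0 0"
  unfolding uniform_measure_def beta_measure_def Beta_nat
  by (intro density_cong) (auto simp: indicator_def)

lemma AE_beta_measure: "AE x in beta_measure s f. x \<in> {0..1}"
  unfolding beta_measure_def by (subst AE_density) (auto simp: indicator_def)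

lemma has_bochner_integral_prior_likelihood:
  "has_bochner_integral (uniform_measure lborel {0..1})
     (\<lambda>x. pmf (bernoulli_pmf x) True ^ s * pmf (bernoulli_pmf x) False ^ f) (sequence_prob (s, f))"
proof -
  have "(\<lambda>x. pmf (bernoulli_pmf x) b) = (\<lambda>x. if b then max 0 (min 1 x) else 1 - max 0 (min 1 x))" for b
    by (auto simp: fun_eq_iff bernoulli_pmf.rep_eq)
  then have [measurable]: "(\<lambda>x. pmf (bernoulli_pmf x) b) \<in> borel_measurable borel" for b
    by (cases b) simp_all
  have "AE x in beta_measure 0 0. x ^ s * (1 - x) ^ f =
      pmf (bernoulli_pmf x) True ^ s * pmf (bernoulli_pmf x) False ^ f"
    using AE_beta_measure by eventually_elim auto
  moreover have "has_bochner_integral (beta_measure 0 0) (\<lambda>x. x ^ s * (1 - x) ^ f) (sequence_prob (s, f))"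
    using has_bochner_integral_beta_measure[of 0 0 s f] by (simp add: sequence_prob_def)
  ultimately show ?thesis
    unfolding uniform_measure_eq_beta by (subst (asm) has_bochner_integral_cong_AE) auto
qed

text \<open>
  Given the history, the likelihood is a product over the arms, and so is the prior; the integral of
  each factor is a Beta integral, that is, \<open>sequence_prob\<close> of the state of the arm.
\<close>
lemma integral_play_prior:
  assumes "h \<in> histories N t"
  shows "integrable (prior N) (\<lambda>\<theta>. pmf (play \<pi> \<theta> t) h)"
    and "(\<integral>\<theta>. pmf (play \<pi> \<theta> t) h \<partial>prior N) = pmf (predictive \<pi> t) h"
proof -
  interpret product_prob_space "\<lambda>_ :: nat. uniform_measure lborel {0..1::real}"
    by (intro product_prob_spaceI) (simp add: uniform_measure_eq_beta prob_space_beta_measure)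
  note h = has_bochner_integral_prior_likelihood
  show "integrable (prior N) (\<lambda>\<theta>. pmf (play \<pi> \<theta> t) h)"
    unfolding prior_def pmf_play[OF assms]
    by (intro integrable_mult_right product_integrable_prod integrable.intros[OF h]) simp
  show "(\<integral>\<theta>. pmf (play \<pi> \<theta> t) h \<partial>prior N) = pmf (predictive \<pi> t) h"
    unfolding prior_def pmf_play[OF assms] pmf_predictive[OF assms]
    by (subst integral_mult_right_zero, subst product_integral_prod)
       (simp_all add: integrable.intros[OF h] has_bochner_integral_integral_eq[OF h])
qed

theorem policy_value_predictive:
  assumes "admissible N \<pi>"
  shows "policy_value T N \<pi> = measure_pmf.expectation (predictive \<pi> T) total_reward"
proof -
  have "policy_value T N \<pi> = (\<integral>\<theta>. (\<Sum>h\<in>histories N T. total_reward h * pmf (play \<pi> \<theta> T) h) \<partial>prior N)"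
    unfolding policy_value_def using set_pmf_play[OF assms]
    by (subst integral_measure_pmf_real[OF finite_histories[of N T]]) auto
  also have "\<dots> = (\<Sum>h\<in>histories N T. total_reward h * pmf (predictive \<pi> T) h)"
    by (simp add: integral_sum integral_play_prior)
  also have "\<dots> = measure_pmf.expectation (predictive \<pi> T) total_reward"
    using set_pmf_predictive[OF assms]
    by (subst integral_measure_pmf_real[OF finite_histories[of N T]]) auto
  finally show ?thesis .
qed

section \<open>Regret in the last period\<close>

lemma expectation_bind_finite:
  fixes g :: "'b \<Rightarrow> real"
  assumes "finite (set_pmf p)" "\<And>x. x \<in> set_pmf p \<Longrightarrow> finite (set_pmf (f x))"
  shows "measure_pmf.expectation (bind_pmf p f) g
     = measure_pmf.expectation p (\<lambda>x. measure_pmf.expectation (f x) g)"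
  using assms by (subst pmf_expectation_bind[OF assms(1)])
    (auto simp: integral_measure_pmf[OF assms(1)])

lemma expectation_predictive_Suc:
  fixes F :: "history \<Rightarrow> real"
  assumes "admissible N \<pi>"
  shows "measure_pmf.expectation (predictive \<pi> (Suc t)) F =
    measure_pmf.expectation (predictive \<pi> t) (\<lambda>h. measure_pmf.expectation (\<pi> h) (\<lambda>S.
      measure_pmf.expectation (Pi_pmf S False (\<lambda>i. bernoulli_pmf (state_mean (state h i))))
        (\<lambda>r. F (h @ [(S, r)]))))"
proof -
  note fin = finite_predictive[OF assms] finite_policy[OF assms]
  have S: "finite S" if "S \<in> set_pmf (\<pi> h)" for S h
    using that set_pmf_policy[OF assms] finite_selection by blast
  show ?thesis
    by (simp add: expectation_bind_finite fin finite_Pi_pmf_bool S)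
qed

lemma expectation_mono_pmf:
  fixes f g :: "'a \<Rightarrow> real"
  assumes "finite (set_pmf p)" "\<And>x. x \<in> set_pmf p \<Longrightarrow> f x \<le> g x"
  shows "measure_pmf.expectation p f \<le> measure_pmf.expectation p g"
  using assms by (intro integral_mono_AE) (auto simp: integrable_measure_pmf_finite AE_measure_pmf_iff)

lemma expectation_component_Pi_pmf:
  fixes g :: "bool \<Rightarrow> real"
  assumes "finite S" "i \<in> S" "0 \<le> p i" "p i \<le> 1"
  shows "measure_pmf.expectation (Pi_pmf S False (\<lambda>i. bernoulli_pmf (p i))) (\<lambda>r. g (r i))
    = g True * p i + g False * (1 - p i)"
proof -
  have "measure_pmf.expectation (Pi_pmf S False (\<lambda>i. bernoulli_pmf (p i))) (\<lambda>r. g (r i))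
      = measure_pmf.expectation (map_pmf (\<lambda>r. r i) (Pi_pmf S False (\<lambda>i. bernoulli_pmf (p i)))) g"
    by simp
  also have "\<dots> = measure_pmf.expectation (bernoulli_pmf (p i)) g"
    using assms by (subst Pi_pmf_component) auto
  finally show ?thesis using assms by simp
qed

lemma total_reward_snoc:
  "total_reward (h @ [(S, r)]) = total_reward h + real (card {i \<in> S. r i})"
  by (simp add: total_reward_def)

lemma policy_value_Suc:
  assumes "admissible N \<pi>"
  shows "policy_value (Suc t) N \<pi> = measure_pmf.expectation (predictive \<pi> t) total_reward +
    measure_pmf.expectation (predictive \<pi> t) (\<lambda>h. measure_pmf.expectation (\<pi> h)
      (\<lambda>S. \<Sum>i\<in>S. state_mean (state h i)))"
proof -
  note fin = finite_predictive[OF assms] finite_policy[OF assms]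
  have r: "measure_pmf.expectation (Pi_pmf S False (\<lambda>i. bernoulli_pmf (state_mean (state h i))))
        (\<lambda>r. total_reward (h @ [(S, r)])) = total_reward h + (\<Sum>i\<in>S. state_mean (state h i))"
    if "S \<in> set_pmf (\<pi> h)" for h S
  proof -
    have S: "finite S" using that set_pmf_policy[OF assms] finite_selection by blast
    have card: "real (card {i \<in> S. r i}) = (\<Sum>i\<in>S. of_bool (r i))" for r
      using S by (simp add: Int_def)
    show ?thesis
      unfolding total_reward_snoc card using S state_mean_bounds
      by (simp del: sum_of_bool_eq cong: sum.cong_simp
          add: integrable_measure_pmf_finite finite_Pi_pmf_bool less_imp_le
            expectation_component_Pi_pmf[where g = of_bool])
  qed
  have "measure_pmf.expectation (\<pi> h) (\<lambda>S. measure_pmf.expectation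
          (Pi_pmf S False (\<lambda>i. bernoulli_pmf (state_mean (state h i)))) (\<lambda>r. total_reward (h @ [(S, r)])))
      = total_reward h + measure_pmf.expectation (\<pi> h) (\<lambda>S. \<Sum>i\<in>S. state_mean (state h i))" for h
  proof -
    have "measure_pmf.expectation (\<pi> h) (\<lambda>S. measure_pmf.expectation
          (Pi_pmf S False (\<lambda>i. bernoulli_pmf (state_mean (state h i)))) (\<lambda>r. total_reward (h @ [(S, r)])))
      = measure_pmf.expectation (\<pi> h) (\<lambda>S. total_reward h + (\<Sum>i\<in>S. state_mean (state h i)))"
      using r by (intro integral_cong_AE) (auto simp: AE_measure_pmf_iff)
    then show ?thesis
      by (simp add: integrable_measure_pmf_finite fin)
  qed
  then show ?thesis
    unfolding policy_value_predictive[OF assms] expectation_predictive_Suc[OF assms]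
    by (simp add: integrable_measure_pmf_finite fin)
qed

definition regret :: "nat \<Rightarrow> history \<Rightarrow> nat set \<Rightarrow> real" where
  "regret N h S = Max ((\<lambda>S. \<Sum>i\<in>S. state_mean (state h i)) ` selections N)
     - (\<Sum>i\<in>S. state_mean (state h i))"

lemma predictive_cong:
  assumes "\<And>h. length h < t \<Longrightarrow> \<pi> h = \<pi>' h" "admissible N \<pi>"
  shows "predictive \<pi> t = predictive \<pi>' t"
  using assms(1)
proof (induction t)
  case (Suc t)
  have "length h = t" if "h \<in> set_pmf (predictive \<pi> t)" for h
    using that set_pmf_predictive[OF assms(2)] by (auto simp: histories_def)
  with Suc show ?case
    by (auto intro!: bind_pmf_cong)
qed simp

lemma total_reward_le:
  assumes "h \<in> histories N t"
  shows "total_reward h \<le> real t * real N"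
  using assms
proof (induction t arbitrary: h)
  case (Suc t)
  from Suc.prems show ?case
  proof (cases rule: histories_SucE)
    case (1 h' S r)
    have "card {i \<in> S. r i} \<le> card {..<N}"
      using 1 by (intro card_mono) (auto simp: selections_def)
    with Suc.IH[OF 1(2)] show ?thesis
      by (simp add: 1(1) total_reward_snoc algebra_simps)
  qed
qed (simp add: histories_0 total_reward_def)

lemma policy_value_le_optimal:
  assumes "admissible N \<pi>"
  shows "policy_value T N \<pi> \<le> optimal_value T N"
proof -
  have "policy_value T N \<pi>' \<le> real T * real N" if "admissible N \<pi>'" for \<pi>'
  proof -
    have "policy_value T N \<pi>' \<le> measure_pmf.expectation (predictive \<pi>' T) (\<lambda>_. real T * real N)"
      unfolding policy_value_predictive[OF that]
      using finite_predictive[OF that] set_pmf_predictive[OF that, of T] total_reward_le[of _ N T]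
      by (intro expectation_mono_pmf) auto
    then show ?thesis by simp
  qed
  then show ?thesis
    unfolding optimal_value_def using assms by (intro cSUP_upper) (auto simp: bdd_above_def)
qed

text \<open>
  The competitor copies \<open>\<pi>\<close> and maximises the sum of the posterior means in the last period. Up to then
  the two histories have the same law, so the values differ exactly by the expected regret of \<open>\<pi>\<close>.
\<close>
theorem optimality_gap_ge_regret:
  assumes "admissible N \<pi>"
  shows "measure_pmf.expectation (predictive \<pi> t) (\<lambda>h. measure_pmf.expectation (\<pi> h) (regret N h))
     \<le> optimal_value (Suc t) N - policy_value (Suc t) N \<pi>"
proof -
  note fin = finite_predictive[OF assms] finite_policy[OF assms]
  let ?v = "\<lambda>h S. \<Sum>i\<in>S. state_mean (state h i)"
  have "\<exists>S \<in> selections N. ?v h S = Max (?v h ` selections N)" for h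
  proof -
    have "selections N \<noteq> {}" using ex_top_selection[of N "\<lambda>_. 0"] by (auto simp: top_selection_def)
    then have "Max (?v h ` selections N) \<in> ?v h ` selections N"
      by (intro Max_in) (auto simp: finite_selections)
    then show ?thesis by auto
  qed
  then obtain G where G: "\<And>h. G h \<in> selections N" "\<And>h. ?v h (G h) = Max (?v h ` selections N)"
    by metis
  define \<pi>' where "\<pi>' = (\<lambda>h. if length h = t then return_pmf (G h) else \<pi> h)"
  have adm: "admissible N \<pi>'"
    using assms G by (auto simp: admissible_def \<pi>'_def)
  have pred: "predictive \<pi>' t = predictive \<pi> t"
    by (rule predictive_cong[OF _ adm]) (simp add: \<pi>'_def)
  have len: "length h = t" if "h \<in> set_pmf (predictive \<pi> t)" for h
    using that set_pmf_predictive[OF assms] by (auto simp: histories_def)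
  have "measure_pmf.expectation (predictive \<pi> t) (\<lambda>h. measure_pmf.expectation (\<pi>' h) (?v h))
      = measure_pmf.expectation (predictive \<pi> t) (\<lambda>h. Max (?v h ` selections N))"
    using len G by (intro integral_cong_AE) (auto simp: AE_measure_pmf_iff \<pi>'_def)
  then have "policy_value (Suc t) N \<pi>' - policy_value (Suc t) N \<pi> =
      measure_pmf.expectation (predictive \<pi> t) (\<lambda>h. measure_pmf.expectation (\<pi> h) (regret N h))"
    unfolding policy_value_Suc[OF adm] policy_value_Suc[OF assms] pred regret_def
    by (simp add: integrable_measure_pmf_finite fin)
  with policy_value_le_optimal[OF adm, of "Suc t"] show ?thesis by simp
qed

text \<open>
  After the exchange of each \<open>i \<in> P\<close> for \<open>\<sigma> i\<close>, the selection still has the required size, so it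
  competes in the maximum that defines the regret.
\<close>
lemma regret_ge_exchange:
  assumes "S \<in> selections N" "P \<subseteq> S" "inj_on \<sigma> P" "\<sigma> ` P \<subseteq> {..<N} - S"
    and "\<And>i. i \<in> P \<Longrightarrow> state_mean (state h i) + \<delta> \<le> state_mean (state h (\<sigma> i))"
  shows "\<delta> * card P \<le> regret N h S"
proof -
  let ?m = "\<lambda>i. state_mean (state h i)"
  define S' where "S' = (S - P) \<union> \<sigma> ` P"
  have fin: "finite S" "finite P" using assms finite_selection finite_subset by blast+
  have "card S' = card (S - P) + card (\<sigma> ` P)"
    unfolding S'_def using assms fin by (intro card_Un_disjoint) auto
  then have "card S' = card S"
    using assms fin by (simp add: card_image card_Diff_subset card_mono)
  then have "S' \<in> selections N"
    using assms by (auto simp: selections_def S'_def)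
  then have "sum ?m S' \<le> Max ((\<lambda>S. sum ?m S) ` selections N)"
    by (intro Max_ge) (auto simp: finite_selections)
  moreover have "sum ?m S' = sum ?m S - sum ?m P + (\<Sum>i\<in>P. ?m (\<sigma> i))"
  proof -
    have "sum ?m S' = sum ?m (S - P) + sum ?m (\<sigma> ` P)"
      unfolding S'_def using assms fin by (intro sum.union_disjoint) auto
    then show ?thesis
      using assms fin by (simp add: sum_diff sum.reindex)
  qed
  moreover have "(\<Sum>i\<in>P. ?m i + \<delta>) \<le> (\<Sum>i\<in>P. ?m (\<sigma> i))"
    using assms(5) by (intro sum_mono)
  ultimately show ?thesis
    by (simp add: regret_def sum.distrib mult.commute)
qed

section \<open>Thompson sampling\<close>

text \<open>
  The density is at most the reciprocal of the normalising constant, hence at most \<open>fact (s + f + 1)\<close>.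
\<close>
lemma measure_beta_le:
  assumes A: "A \<in> sets borel" "A \<inter> {0..1} \<subseteq> {a..b}" and "a \<le> b"
  shows "measure (beta_measure s f) A \<le> fact (s + f + 1) * (b - a)"
proof -
  let ?B = "Beta (real s + 1) (real f + 1)"
  have "1 \<le> fact s * (fact f :: real)"
    using fact_ge_1[of s, where 'a = real] fact_ge_1[of f, where 'a = real] mult_mono[of 1 "fact s :: real" 1 "fact f"]
    by simp
  then have B: "1 / ?B \<le> fact (s + f + 1)"
    unfolding Beta_nat by (simp add: field_simps del: fact_Suc)
  have le: "x ^ s * (1 - x) ^ f / ?B \<le> fact (s + f + 1)" if "x \<in> {0..1}" for x
  proof -
    have "x ^ s * (1 - x) ^ f \<le> 1 * 1"
      using that by (intro mult_mono power_le_one) auto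
    then have "x ^ s * (1 - x) ^ f / ?B \<le> 1 / ?B"
      using Beta_nat_pos[of s f] by (intro divide_right_mono) auto
    with B show ?thesis by simp
  qed
  have "emeasure (beta_measure s f) A =
      (\<integral>\<^sup>+x. ennreal (indicator {0..1} x * (x ^ s * (1 - x) ^ f) / ?B) * indicator A x \<partial>lborel)"
    using A by (simp add: beta_measure_def emeasure_density)
  also have "\<dots> \<le> (\<integral>\<^sup>+x. ennreal (fact (s + f + 1)) * indicator {a..b} x \<partial>lborel)"
  proof (intro nn_integral_mono)
    fix x :: real
    show "ennreal (indicator {0..1} x * (x ^ s * (1 - x) ^ f) / ?B) * indicator A x
        \<le> ennreal (fact (s + f + 1)) * indicator {a..b} x"
      using le[of x] A(2) by (auto simp: indicator_def simp del: fact_Suc intro: ennreal_leI)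
  qed
  also have "\<dots> = ennreal (fact (s + f + 1) * (b - a))"
    using assms(3) by (simp add: nn_integral_cmult_indicator ennreal_mult' del: fact_Suc)
  finally show ?thesis
    unfolding measure_def using assms(3)
    by (intro enn2real_leI) (auto simp del: fact_Suc)
qed

text \<open>
  The normalising constant is at most 1, so on an interval that keeps distance \<open>\<eta>\<close> from 0 and 1 the
  density is at least \<open>\<eta> ^ (s + f)\<close>.
\<close>
lemma measure_beta_ge:
  assumes A: "A \<in> sets borel" "{a..b} \<subseteq> A" and "a \<le> b" "0 \<le> \<eta>" "\<eta> \<le> a" "b \<le> 1 - \<eta>"
  shows "(b - a) * \<eta> ^ (s + f) \<le> measure (beta_measure s f) A"
proof -
  interpret prob_space "beta_measure s f" by (rule prob_space_beta_measure)
  let ?B = "Beta (real s + 1) (real f + 1)"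
  have "fact s * fact f \<le> (fact (s + f) :: nat)"
    by (rule dvd_imp_le[OF fact_fact_dvd_fact]) simp
  then have "fact s * fact f \<le> (fact (s + f + 1) :: nat)"
    using fact_mono_nat[of "s + f" "s + f + 1"] by linarith
  then have "fact s * fact f \<le> (fact (s + f + 1) :: real)"
    by (metis of_nat_fact of_nat_le_iff of_nat_mult)
  then have B: "?B \<le> 1"
    unfolding Beta_nat by (simp del: fact_Suc)
  have ge: "\<eta> ^ (s + f) \<le> x ^ s * (1 - x) ^ f / ?B" if "x \<in> {a..b}" for x
  proof -
    have "\<eta> ^ s * \<eta> ^ f \<le> x ^ s * (1 - x) ^ f"
      using that assms by (intro mult_mono power_mono) auto
    also have "\<dots> \<le> x ^ s * (1 - x) ^ f / ?B"
      using B Beta_nat_pos[of s f] that assms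
      by (auto simp: le_divide_eq intro!: mult_left_le)
    finally show ?thesis by (simp add: power_add)
  qed
  have "ennreal ((b - a) * \<eta> ^ (s + f)) = (\<integral>\<^sup>+x. ennreal (\<eta> ^ (s + f)) * indicator {a..b} x \<partial>lborel)"
    using assms by (subst nn_integral_cmult_indicator) (simp_all add: ennreal_mult' mult.commute)
  also have "\<dots> \<le> (\<integral>\<^sup>+x. ennreal (indicator {0..1} x * (x ^ s * (1 - x) ^ f) / ?B) * indicator A x \<partial>lborel)"
  proof (intro nn_integral_mono)
    fix x :: real
    show "ennreal (\<eta> ^ (s + f)) * indicator {a..b} x
      \<le> ennreal (indicator {0..1} x * (x ^ s * (1 - x) ^ f) / ?B) * indicator A x"
      using ge[of x] assms by (auto simp: indicator_def intro: ennreal_leI)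
  qed
  also have "\<dots> = emeasure (beta_measure s f) A"
    using A by (simp add: beta_measure_def emeasure_density)
  finally show ?thesis
    using assms by (simp add: emeasure_eq_measure)
qed

lemma sets_top_selection:
  "{x \<in> space (PiM {..<N} (posterior h)). top_selection N x S} \<in> sets (PiM {..<N} (posterior h))"
proof (cases "S \<in> selections N")
  case True
  let ?P = "PiM {..<N} (posterior h)"
  have comp: "(\<lambda>x. x k) \<in> borel_measurable ?P" if "k < N" for k
    using measurable_component_singleton[of k "{..<N}" "posterior h"] that
    unfolding posterior_def measurable_cong_sets[OF refl sets_beta_measure] by simp
  have le: "Measurable.pred ?P (\<lambda>x. x j \<le> x i)" if "i < N" "j < N" for i j
    unfolding pred_def by (rule borel_measurable_le[OF comp[OF that(2)] comp[OF that(1)]])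
  have "Measurable.pred ?P (\<lambda>x. \<forall>i \<in> S. \<forall>j \<in> {..<N} - S. x j \<le> x i)"
  proof (intro pred_intros_finite(3) le)
    show "finite S" by (rule finite_selection[OF True])
  qed (use True in \<open>auto simp: selections_def\<close>)
  with True show ?thesis
    by (simp add: top_selection_def pred_def)
qed (simp add: top_selection_def)

text \<open>
  If \<open>i\<close> were not selected, then all selected arms would have values above \<open>a\<close>, but there are too few
  of these; if \<open>j\<close> were selected, then all other arms would have values below \<open>b\<close>.
\<close>
lemma top_selection_separates:
  assumes top: "top_selection N x S" and i: "i < N" "a < x i" and j: "j < N" "x j < b"
    and H: "card {k \<in> {..<N} - {i, j}. a < x k} < N div 3"
    and L: "card {k \<in> {..<N} - {i, j}. x k < b} < N - N div 3"
    and "b \<le> a"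
  shows "i \<in> S" "j \<notin> S"
proof -
  have S: "S \<subseteq> {..<N}" "finite S" "card S = N div 3"
    and le: "\<And>k l. k \<in> S \<Longrightarrow> l < N \<Longrightarrow> l \<notin> S \<Longrightarrow> x l \<le> x k"
    using top by (auto simp: top_selection_def selections_def intro: finite_subset)
  show "i \<in> S"
  proof (rule ccontr)
    assume "i \<notin> S"
    have "a < x k" if "k \<in> S" for k
      using \<open>i \<notin> S\<close> le[OF that, of i] i by simp
    moreover from this have "j \<notin> S"
      using j assms(8) by force
    ultimately have "S \<subseteq> {k \<in> {..<N} - {i, j}. a < x k}"
      using S(1) \<open>i \<notin> S\<close> by blast
    then have "card S \<le> card {k \<in> {..<N} - {i, j}. a < x k}"
      by (intro card_mono) auto
    with H S show False by simp
  qed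
  show "j \<notin> S"
  proof
    assume "j \<in> S"
    have "x k < b" if "k \<in> {..<N} - S" for k
      using \<open>j \<in> S\<close> le[of j k] j that by simp
    moreover from this have "i \<notin> {..<N} - S"
      using i assms(8) by force
    ultimately have "{..<N} - S \<subseteq> {k \<in> {..<N} - {i, j}. x k < b}"
      using \<open>j \<in> S\<close> by blast
    then have "card ({..<N} - S) \<le> card {k \<in> {..<N} - {i, j}. x k < b}"
      by (intro card_mono) auto
    moreover have "card ({..<N} - S) = N - N div 3"
      using S by (simp add: card_Diff_subset)
    ultimately show False using L by simp
  qed
qed

text \<open>
  The number \<open>\<epsilon>\<close> is so small that each sample exceeds \<open>1 - \<epsilon>\<close>, or falls below \<open>\<epsilon>\<close>, with probability at
  most 1/16. By Markov's inequality and \<open>N \<le> 4 * (N div 3)\<close>, there are then \<open>N div 3\<close> such large samples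
  among the other arms with probability at most 1/4, and \<open>N - N div 3\<close> such small ones with probability
  at most 1/4. In the remaining half of the cases, \<open>top_selection_separates\<close> applies if the samples of
  \<open>i\<close> and \<open>j\<close> are extreme, and these two are independent of the others.
\<close>
lemma thompson_separates_pairs:
  "\<exists>c>0. \<forall>N\<ge>12. \<forall>t\<le>n. \<forall>h\<in>histories N t. \<forall>i<N. \<forall>j<N. i \<noteq> j \<longrightarrow>
     c \<le> measure_pmf.prob (thompson N h) {S. i \<in> S \<and> j \<notin> S}"
proof -
  define \<epsilon> :: real where "\<epsilon> = 1 / (16 * fact (n + 1))"
  define p :: real where "p = (\<epsilon> / 4) ^ (n + 1)"
  have \<epsilon>: "0 < \<epsilon>" "\<epsilon> \<le> 1 / 16"
    using fact_ge_1[of "n + 1", where 'a = real] by (auto simp: \<epsilon>_def field_simps simp del: fact_Suc)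
  define H L where "H = {1 - \<epsilon><..}" and "L = {..<\<epsilon>}"
  have [measurable]: "H \<in> sets borel" "L \<in> sets borel" by (simp_all add: H_def L_def)
  have small: "measure (beta_measure s f) A \<le> 1 / 16" if "s + f \<le> n" "A = H \<or> A = L" for s f A
  proof -
    have "measure (beta_measure s f) A \<le> fact (s + f + 1) * \<epsilon>"
    proof (cases "A = H")
      case True
      then show ?thesis
        using measure_beta_le[of H "1 - \<epsilon>" 1 s f] \<epsilon> by (auto simp: H_def subset_iff)
    next
      case False
      then show ?thesis
        using measure_beta_le[of L 0 \<epsilon> s f] \<epsilon> that by (auto simp: L_def subset_iff)
    qed
    also have "\<dots> \<le> fact (n + 1) * \<epsilon>"
      using that \<epsilon> by (intro mult_right_mono fact_mono) auto
    finally show ?thesis by (simp add: \<epsilon>_def del: fact_Suc)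
  qed
  have large: "p \<le> measure (beta_measure s f) A" if "s + f \<le> n" "A = H \<or> A = L" for s f A
  proof -
    have "p \<le> (\<epsilon> / 4) ^ (s + f + 1)"
      unfolding p_def using \<epsilon> that by (intro power_decreasing) auto
    also have "\<dots> \<le> (\<epsilon> / 2) * (\<epsilon> / 4) ^ (s + f)"
      using \<epsilon> by (simp add: mult_right_mono)
    also have "\<dots> \<le> measure (beta_measure s f) A"
    proof (cases "A = H")
      case True
      have "{1 - \<epsilon> * (3/4)..1 - \<epsilon> / 4} \<subseteq> H" using \<epsilon> by (auto simp: H_def)
      then show ?thesis
        using measure_beta_ge[of H "1 - \<epsilon> * (3/4)" "1 - \<epsilon> / 4" "\<epsilon> / 4" s f] \<epsilon> True by simp
    next
      case False
      have "{\<epsilon> / 4..\<epsilon> * (3/4)} \<subseteq> L" using \<epsilon> by (auto simp: L_def)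
      then show ?thesis
        using measure_beta_ge[of L "\<epsilon> / 4" "\<epsilon> * (3/4)" "\<epsilon> / 4" s f] \<epsilon> False that by simp
    qed
    finally show ?thesis .
  qed
  show ?thesis
  proof (intro exI[of _ "p\<^sup>2 / 2"] conjI allI impI ballI)
    show "0 < p\<^sup>2 / 2" using \<epsilon> by (simp add: p_def)
    fix N t h i j
    assume N: "12 \<le> N" and t: "t \<le> n" and h: "h \<in> histories N t" and ij: "i < N" "j < N" "i \<noteq> j"
    let ?P = "PiM {..<N} (posterior h)"
    interpret product_prob_space "posterior h" "{..<N}"
      by (intro product_prob_spaceI) (simp add: posterior_def prob_space_beta_measure)
    have st: "successes h k + failures h k \<le> n" for k
      using state_sum_le[OF h, of k] t by simp
    have small: "measure (posterior h k) H \<le> 1 / 16" "measure (posterior h k) L \<le> 1 / 16" for k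
      using small[OF st[of k]] by (simp_all add: posterior_def)
    have large: "p \<le> measure (posterior h k) H" "p \<le> measure (posterior h k) L" for k
      using large[OF st[of k]] by (simp_all add: posterior_def)
    have p: "0 < p" using \<epsilon> by (simp add: p_def)
    let ?R = "{..<N} - {i, j}"
    let ?K = "N div 3"
    define W where "W = (\<lambda>J X. {x \<in> space ?P. \<forall>l\<in>J. x l \<in> X l})"
    have W: "W J X \<in> sets ?P" "P.prob (W J X) = (\<Prod>l\<in>J. measure (posterior h l) (X l))"
      if "J \<subseteq> {..<N}" "\<And>l. X l \<in> sets borel" for J X
    proof -
      have X: "X l \<in> sets (posterior h l)" for l using that by (simp add: posterior_def)
      have "W J X = prod_emb {..<N} (posterior h) J (PiE J X)"
        using that(1) unfolding W_def prod_emb_def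
        by (auto simp: space_PiM restrict_PiE_iff)
      moreover have "finite J" using that finite_subset by blast
      ultimately show "W J X \<in> sets ?P" "P.prob (W J X) = (\<Prod>l\<in>J. measure (posterior h l) (X l))"
        using that X by (auto intro!: sets_PiM_I measure_PiM_emb)
    qed
    define X where "X = (\<lambda>A l. if l = i then H else if l = j then L else A)"
    have X: "X A l \<in> sets borel" if "A \<in> sets borel" for A l
      using that by (simp add: X_def)
    define pp where "pp = measure (posterior h i) H * measure (posterior h j) L"
    have pp: "p\<^sup>2 \<le> pp"
      unfolding pp_def power2_eq_square using large p by (intro mult_mono) (auto intro: less_imp_le)
    define E where "E = (\<lambda>S. {x \<in> space ?P. top_selection N x S})"
    have E: "E S \<in> sets ?P" for S
      unfolding E_def by (rule sets_top_selection)
    define good where "good = {S \<in> selections N. i \<in> S \<and> j \<notin> S}"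
    \<comment> \<open>Markov's inequality in pointwise form: \<open>g\<close> is positive only if the samples of \<open>i\<close> and \<open>j\<close> are extreme
      and too few of the others are, and its integral only involves probabilities of boxes.\<close>
    define g where "g = (\<lambda>x. indicator (W {i, j} (X UNIV)) x
        - (\<Sum>k\<in>?R. indicator (W {i, j, k} (X H)) x) / real ?K
        - (\<Sum>k\<in>?R. indicator (W {i, j, k} (X L)) x) / real (N - ?K) :: real)"
    have K: "0 < ?K" "real N \<le> 4 * real ?K" "0 < N - ?K" "real N \<le> 4 * real (N - ?K)"
      using N by linarith+
    have g_le: "g x \<le> (\<Sum>S\<in>good. indicator (E S) x)" if x: "x \<in> space ?P" for x
    proof (cases "x i \<in> H \<and> x j \<in> L")
      case False
      then have "g x = 0"
        using ij by (auto simp: g_def W_def X_def indicator_def)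
      then show ?thesis by (simp add: sum_nonneg)
    next
      case True
      then have g: "g x = 1 - real (card {k \<in> ?R. x k \<in> H}) / real ?K
          - real (card {k \<in> ?R. x k \<in> L}) / real (N - ?K)"
      proof -
        have "(\<Sum>k\<in>?R. indicator (W {i, j, k} (X A)) x) = real (card {k \<in> ?R. x k \<in> A})" for A
        proof -
          have "(\<Sum>k\<in>?R. indicator (W {i, j, k} (X A)) x :: real) = (\<Sum>k\<in>?R. of_bool (x k \<in> A))"
            using True x ij by (intro sum.cong) (auto simp: W_def X_def indicator_def)
          then show ?thesis by (simp add: Int_def)
        qed
        then show ?thesis
          using True x ij by (simp add: g_def W_def X_def)
      qed
      have nonneg: "0 \<le> real (card {k \<in> ?R. x k \<in> H}) / real ?K"
        "0 \<le> real (card {k \<in> ?R. x k \<in> L}) / real (N - ?K)"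
        by (intro divide_nonneg_nonneg of_nat_0_le_iff)+
      show ?thesis
      proof (cases "card {k \<in> ?R. x k \<in> H} < ?K \<and> card {k \<in> ?R. x k \<in> L} < N - ?K")
        case True': True
        obtain S where S: "top_selection N x S" using ex_top_selection by blast
        have "i \<in> S" "j \<notin> S"
          using top_selection_separates[OF S ij(1) _ ij(2), of "1 - \<epsilon>" \<epsilon>] True True' \<epsilon>
          by (auto simp: H_def L_def)
        then have "S \<in> good" using S by (simp add: good_def top_selection_def)
        moreover have "finite good" by (simp add: good_def finite_selections)
        ultimately have "indicator (E S) x \<le> (\<Sum>S\<in>good. indicator (E S) x :: real)"
          by (intro member_le_sum) auto
        moreover have "g x \<le> 1" unfolding g using nonneg by linarith
        ultimately show ?thesis using S x by (simp add: E_def)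
      next
        case False
        then have "1 \<le> real (card {k \<in> ?R. x k \<in> H}) / real ?K
            \<or> 1 \<le> real (card {k \<in> ?R. x k \<in> L}) / real (N - ?K)"
          using K(1,3) unfolding not_less de_Morgan_conj
          by (simp only: le_divide_eq_1_pos of_nat_0_less_iff of_nat_le_iff)
        then have "g x \<le> 0"
          unfolding g using nonneg by linarith
        also have "0 \<le> (\<Sum>S\<in>good. indicator (E S) x :: real)"
          by (intro sum_nonneg) simp
        finally show ?thesis .
      qed
    qed
    have Wk: "P.prob (W {i, j, k} (X A)) \<le> pp / 16" if "k \<in> ?R" "A = H \<or> A = L" for k A
    proof -
      have "P.prob (W {i, j, k} (X A)) = pp * measure (posterior h k) A"
        using that ij X by (subst W(2)) (auto simp: X_def pp_def)
      also have "\<dots> \<le> pp * (1 / 16)"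
        using that small by (intro mult_left_mono) (auto simp: pp_def)
      finally show ?thesis by simp
    qed
    have W0: "P.prob (W {i, j} (X UNIV)) = pp"
      using ij X by (subst W(2)) (auto simp: X_def pp_def)
    have Wsets [measurable]: "W {i, j} (X UNIV) \<in> sets ?P" "W {i, j, k} (X H) \<in> sets ?P"
      "W {i, j, k} (X L) \<in> sets ?P" if "k \<in> ?R" for k
      using that ij X by (auto intro!: W(1))
    have "p\<^sup>2 / 2 \<le> pp / 2" using pp by simp
    also have "\<dots> \<le> P.expectation g"
    proof -
      have i1: "integrable ?P (\<lambda>x. indicator A x :: real)" if "A \<in> sets ?P" for A
        using that by (simp add: P.emeasure_eq_measure)
      have W00: "W {i, j} (X UNIV) \<in> sets ?P" using ij X by (auto intro!: W(1))
      have bound: "(\<Sum>k\<in>?R. P.prob (W {i, j, k} (X A))) / real m \<le> pp / 4"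
        if "A = H \<or> A = L" "0 < m" "real N \<le> 4 * real m" for A m
      proof -
        have "(\<Sum>k\<in>?R. P.prob (W {i, j, k} (X A))) \<le> (\<Sum>k\<in>?R. pp / 16)"
          using Wk that by (intro sum_mono) auto
        also have "\<dots> \<le> real N * (pp / 16)"
        proof -
          have "0 \<le> pp" by (simp add: pp_def)
          moreover have "card ?R \<le> N" using card_mono[of "{..<N}" ?R] by simp
          ultimately show ?thesis by (simp add: mult_right_mono)
        qed
        also have "\<dots> \<le> 4 * real m * (pp / 16)"
          using that pp zero_le_power2[of p] by (intro mult_right_mono) linarith+
        finally show ?thesis using that by (simp add: field_simps)
      qed
      have "P.expectation g = pp - (\<Sum>k\<in>?R. P.prob (W {i, j, k} (X H))) / real ?K
         - (\<Sum>k\<in>?R. P.prob (W {i, j, k} (X L))) / real (N - ?K)"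
        unfolding g_def using W00 Wsets W0 by (simp add: i1)
      with bound[of H ?K] bound[of L "N - ?K"] K show ?thesis by simp
    qed
    also have "\<dots> \<le> P.expectation (\<lambda>x. \<Sum>S\<in>good. indicator (E S) x)"
    proof (intro integral_mono)
      show "integrable ?P g" unfolding g_def
        using Wsets W(1)[of "{i, j}" "X UNIV"] ij X
        by (intro Bochner_Integration.integrable_diff Bochner_Integration.integrable_divide_zero
            Bochner_Integration.integrable_sum) (auto simp: P.emeasure_eq_measure)
      show "integrable ?P (\<lambda>x. \<Sum>S\<in>good. indicator (E S) x :: real)"
        using E by (intro Bochner_Integration.integrable_sum) (simp add: P.emeasure_eq_measure)
    qed (rule g_le)
    also have "\<dots> = (\<Sum>S\<in>good. P.prob (E S))"
      using E by (subst Bochner_Integration.integral_sum) (simp_all add: P.emeasure_eq_measure)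
    also have "\<dots> = measure_pmf.prob (thompson N h) good"
      by (simp add: measure_measure_pmf_finite good_def finite_selections pmf_thompson E_def)
    also have "\<dots> \<le> measure_pmf.prob (thompson N h) {S. i \<in> S \<and> j \<notin> S}"
      by (intro measure_pmf.finite_measure_mono) (auto simp: good_def)
    finally show "p\<^sup>2 / 2 \<le> measure_pmf.prob (thompson N h) {S. i \<in> S \<and> j \<notin> S}" .
  qed
qed

definition partner :: "nat \<Rightarrow> nat" where
  "partner i = (if even i then i + 1 else i - 1)"

lemma inj_partner: "inj partner"
  by (intro injI) (simp add: partner_def split: if_splits, presburger+)

lemma sum_split_pairs:
  fixes f :: "nat \<Rightarrow> 'a :: comm_monoid_add"
  shows "(\<Sum>i<2 * m. f i) = (\<Sum>k<m. f (2 * k) + f (2 * k + 1))"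
  by (induction m) (simp_all add: add.assoc)

text \<open>
  Means are fractions whose denominators are at most \<open>n + 2\<close>, so different ones cannot be too close.
\<close>
lemma state_mean_gap:
  assumes "state_mean a < state_mean b" "fst a + snd a \<le> n" "fst b + snd b \<le> n"
  shows "state_mean a + 1 / (real n + 2)\<^sup>2 \<le> state_mean b"
proof -
  define u v where "u = real (fst a) + real (snd a) + 2" and "v = real (fst b) + real (snd b) + 2"
  have pos: "0 < u" "0 < v" by (auto simp: u_def v_def)
  have le: "u \<le> real n + 2" "v \<le> real n + 2"
    using assms(2,3) unfolding u_def v_def by linarith+
  have "(real (fst a) + 1) * v < (real (fst b) + 1) * u"
    using assms(1) pos unfolding state_mean_def u_def[symmetric] v_def[symmetric]
    by (simp add: field_simps)
  then have "real ((fst a + 1) * (fst b + snd b + 2)) < real ((fst b + 1) * (fst a + snd a + 2))"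
    unfolding u_def v_def by (simp only: of_nat_add of_nat_mult of_nat_1 of_nat_numeral)
  then have "(fst a + 1) * (fst b + snd b + 2) + 1 \<le> (fst b + 1) * (fst a + snd a + 2)"
    by (simp only: of_nat_less_iff)
  then have "real ((fst a + 1) * (fst b + snd b + 2) + 1) \<le> real ((fst b + 1) * (fst a + snd a + 2))"
    by (simp only: of_nat_le_iff)
  then have "(real (fst a) + 1) * v + 1 \<le> (real (fst b) + 1) * u"
    unfolding u_def v_def by (simp only: of_nat_add of_nat_mult of_nat_1 of_nat_numeral)
  then have "((real (fst a) + 1) * v + 1) / (u * v) \<le> (real (fst b) + 1) * u / (u * v)"
    using pos by (intro divide_right_mono) auto
  then have "state_mean a + 1 / (u * v) \<le> state_mean b"
    using pos unfolding state_mean_def u_def[symmetric] v_def[symmetric]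
    by (simp add: add_divide_distrib)
  moreover have "1 / (real n + 2)\<^sup>2 \<le> 1 / (u * v)"
    using pos le unfolding power2_eq_square by (intro divide_left_mono mult_mono) auto
  ultimately show ?thesis by linarith
qed

lemma state_mean_changes:
  "state_mean (s, Suc f) < state_mean (s, f)" "state_mean (s, f) < state_mean (Suc s, f)"
  by (simp_all add: state_mean_def divide_simps) (simp_all add: algebra_simps add_pos_nonneg)

lemma state_mean_margin:
  assumes "fst a + snd a \<le> n"
  shows "1 / (real n + 2) \<le> state_mean a" "1 / (real n + 2) \<le> 1 - state_mean a"
proof -
  have "real (fst a) + real (snd a) \<le> real n" using assms by linarith
  then show "1 / (real n + 2) \<le> state_mean a"
    unfolding state_mean_def by (intro frac_le) auto
  have "1 - state_mean a = (real (snd a) + 1) / (real (fst a) + real (snd a) + 2)"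
    by (simp add: state_mean_def field_simps add_pos_nonneg)
  also have "1 / (real n + 2) \<le> \<dots>"
    using \<open>real (fst a) + real (snd a) \<le> real n\<close> by (intro frac_le) auto
  finally show "1 / (real n + 2) \<le> 1 - state_mean a" .
qed

lemma regret_ge_misordered_pairs:
  assumes S: "S \<in> selections N" and h: "h \<in> histories N t"
  defines "m \<equiv> \<lambda>i. state_mean (state h i)"
  shows "(\<Sum>k<N div 2. of_bool (2 * k \<in> S \<and> 2 * k + 1 \<notin> S \<and> m (2 * k) < m (2 * k + 1)) +
      of_bool (2 * k + 1 \<in> S \<and> 2 * k \<notin> S \<and> m (2 * k + 1) < m (2 * k))) / (real t + 2)\<^sup>2
    \<le> regret N h S"
proof -
  define P where "P = {i \<in> S. partner i < N \<and> partner i \<notin> S \<and> m i < m (partner i)}"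
  have "1 / (real t + 2)\<^sup>2 * real (card P) \<le> regret N h S"
  proof (rule regret_ge_exchange[OF S])
    show "state_mean (state h i) + 1 / (real t + 2)\<^sup>2 \<le> state_mean (state h (partner i))" if "i \<in> P" for i
      using that state_sum_le[OF h] by (intro state_mean_gap) (auto simp: P_def m_def)
  qed (use inj_partner in \<open>auto simp: P_def inj_on_def\<close>)
  moreover have "(\<Sum>k<N div 2. of_bool (2 * k \<in> S \<and> 2 * k + 1 \<notin> S \<and> m (2 * k) < m (2 * k + 1)) +
      of_bool (2 * k + 1 \<in> S \<and> 2 * k \<notin> S \<and> m (2 * k + 1) < m (2 * k))) \<le> real (card P)"
  proof -
    have P: "P \<subseteq> {..<N}" using S by (auto simp: P_def selections_def)
    have "(\<Sum>k<N div 2. of_bool (2 * k \<in> S \<and> 2 * k + 1 \<notin> S \<and> m (2 * k) < m (2 * k + 1)) +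
      of_bool (2 * k + 1 \<in> S \<and> 2 * k \<notin> S \<and> m (2 * k + 1) < m (2 * k)))
      = (\<Sum>k<N div 2. of_bool (2 * k \<in> P) + of_bool (2 * k + 1 \<in> P) :: real)"
    proof (intro sum.cong refl arg_cong2[where f = "(+)"] arg_cong[where f = of_bool])
      fix k assume "k \<in> {..<N div 2}"
      then have "2 * k + 1 < N" by auto
      then show "(2 * k \<in> S \<and> 2 * k + 1 \<notin> S \<and> m (2 * k) < m (2 * k + 1)) = (2 * k \<in> P)"
        "(2 * k + 1 \<in> S \<and> 2 * k \<notin> S \<and> m (2 * k + 1) < m (2 * k)) = (2 * k + 1 \<in> P)"
        by (auto simp: P_def partner_def)
    qed
    also have "\<dots> = (\<Sum>i<2 * (N div 2). of_bool (i \<in> P))"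
      by (simp only: sum_split_pairs)
    also have "\<dots> \<le> (\<Sum>i<N. of_bool (i \<in> P))"
      by (intro sum_mono2) auto
    also have "\<dots> = real (card P)"
      using P by (simp add: Int_absorb1 Int_absorb2)
    finally show ?thesis .
  qed
  then have "(\<Sum>k<N div 2. of_bool (2 * k \<in> S \<and> 2 * k + 1 \<notin> S \<and> m (2 * k) < m (2 * k + 1)) +
      of_bool (2 * k + 1 \<in> S \<and> 2 * k \<notin> S \<and> m (2 * k + 1) < m (2 * k))) / (real t + 2)\<^sup>2
    \<le> 1 / (real t + 2)\<^sup>2 * real (card P)"
    by (simp add: divide_right_mono)
  ultimately show ?thesis by linarith
qed

lemma expectation_of_bool: "measure_pmf.expectation p (\<lambda>x. of_bool (Q x)) = measure_pmf.prob p {x. Q x}"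
proof -
  have "(\<lambda>x. of_bool (Q x)) = (indicator {x. Q x} :: _ \<Rightarrow> real)"
    by (auto simp: indicator_def)
  then show ?thesis by simp
qed

text \<open>
  Two periods are needed: one that makes the means of a pair of arms different, and the last one, in
  which the pair is separated in the wrong order.
\<close>
theorem thompson_gap_linear:
  "\<exists>c>0. \<forall>N\<ge>12. c * real N \<le> optimal_value (Suc (Suc t)) N - policy_value (Suc (Suc t)) N (thompson N)"
proof -
  obtain c where c: "0 < c" and sep: "\<And>N h i j k. 12 \<le> N \<Longrightarrow> k \<le> Suc t \<Longrightarrow> h \<in> histories N k \<Longrightarrow>
      i < N \<Longrightarrow> j < N \<Longrightarrow> i \<noteq> j \<Longrightarrow> c \<le> measure_pmf.prob (thompson N h) {S. i \<in> S \<and> j \<notin> S}"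
    using thompson_separates_pairs[of "Suc t"] by metis
  define \<delta> where "\<delta> = 1 / (real (Suc t) + 2)\<^sup>2"
  define q where "q = 1 / (real t + 2)"
  have \<delta>: "0 < \<delta>" and q: "0 < q" by (simp_all add: \<delta>_def q_def)
  show ?thesis
  proof (intro exI[of _ "\<delta> * c * (c * q) / 4"] conjI allI impI)
    show "0 < \<delta> * c * (c * q) / 4" using c \<delta> q by simp
    fix N :: nat assume N: "12 \<le> N"
    let ?T = "thompson N"
    note adm = admissible_thompson[of N]
    note fin = finite_predictive[OF adm] finite_policy[OF adm]
    let ?differ = "\<lambda>h i j. state_mean (state h i) \<noteq> state_mean (state h j)"
    \<comment> \<open>If \<open>i\<close> is pulled and \<open>j\<close> is not, then the mean of \<open>j\<close> stays fixed, while success and failure lead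
      to different means of \<open>i\<close>; at least one of the two outcomes therefore makes the means differ.\<close>
    have differ: "c * q \<le> measure_pmf.expectation (predictive ?T (Suc t)) (\<lambda>h. of_bool (?differ h i j))"
      if ij: "i < N" "j < N" "i \<noteq> j" for i j
    proof -
      let ?p = "\<lambda>h S. Pi_pmf S False (\<lambda>i. bernoulli_pmf (state_mean (state h i)))"
      have r: "q * of_bool (i \<in> S \<and> j \<notin> S) \<le>
          measure_pmf.expectation (?p h S) (\<lambda>r. of_bool (?differ (h @ [(S, r)]) i j))"
        if h: "h \<in> histories N t" and S: "S \<in> set_pmf (?T h)" for h S
      proof (cases "i \<in> S \<and> j \<notin> S")
        case True
        obtain s f where sf: "state h i = (s, f)" by simp
        define g where "g = (\<lambda>b. of_bool (state_mean (if b then (Suc s, f) else (s, Suc f))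
          \<noteq> state_mean (state h j)) :: real)"
        have "finite S" using S set_pmf_policy[OF adm] finite_selection by blast
        moreover have "(\<lambda>r. of_bool (?differ (h @ [(S, r)]) i j)) = (\<lambda>r. g (r i))"
          using True sf by (auto simp: g_def state_snoc fun_eq_iff)
        ultimately have "measure_pmf.expectation (?p h S) (\<lambda>r. of_bool (?differ (h @ [(S, r)]) i j))
            = g True * state_mean (s, f) + g False * (1 - state_mean (s, f))"
          using True state_mean_bounds[of "(s, f)"] sf
            expectation_component_Pi_pmf[of S i "\<lambda>i. state_mean (state h i)" g]
          by (simp add: less_imp_le)
        moreover have "g True = 1 \<or> g False = 1"
          using state_mean_changes[of s f] by (auto simp: g_def)
        moreover have "q \<le> state_mean (s, f)" "q \<le> 1 - state_mean (s, f)"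
          using state_mean_margin[of "(s, f)" t] state_sum_le[OF h, of i] sf by (auto simp: q_def)
        moreover have "0 \<le> g True" "0 \<le> g False" by (simp_all add: g_def)
        ultimately show ?thesis
          using True q by (auto intro: add_increasing add_increasing2)
      qed (auto simp: expectation_of_bool)
      have "c * q \<le> measure_pmf.expectation (predictive ?T t) (\<lambda>h. c * q)" by simp
      also have "\<dots> \<le> measure_pmf.expectation (predictive ?T t) (\<lambda>h. measure_pmf.expectation (?T h)
          (\<lambda>S. q * of_bool (i \<in> S \<and> j \<notin> S)))"
      proof (rule expectation_mono_pmf[OF fin(1)])
        fix h assume "h \<in> set_pmf (predictive ?T t)"
        then have "h \<in> histories N t" using set_pmf_predictive[OF adm] by auto
        then show "c * q \<le> measure_pmf.expectation (?T h) (\<lambda>S. q * of_bool (i \<in> S \<and> j \<notin> S))"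
          using sep[OF N _ _ ij, of t] q by (simp add: expectation_of_bool mult.commute del: of_bool_conj)
      qed
      also have "\<dots> \<le> measure_pmf.expectation (predictive ?T (Suc t)) (\<lambda>h. of_bool (?differ h i j))"
        unfolding expectation_predictive_Suc[OF adm]
        using set_pmf_predictive[OF adm, of t] r by (intro expectation_mono_pmf fin) blast
      finally show ?thesis .
    qed
    have regret: "\<delta> * (\<Sum>k<N div 2. c * of_bool (?differ h (2 * k) (2 * k + 1)))
        \<le> measure_pmf.expectation (?T h) (regret N h)" if h: "h \<in> histories N (Suc t)" for h
    proof -
      let ?m = "\<lambda>i. state_mean (state h i)"
      let ?B = "\<lambda>S k. of_bool (2 * k \<in> S \<and> 2 * k + 1 \<notin> S \<and> ?m (2 * k) < ?m (2 * k + 1)) +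
          of_bool (2 * k + 1 \<in> S \<and> 2 * k \<notin> S \<and> ?m (2 * k + 1) < ?m (2 * k)) :: real"
      have pair: "c * of_bool (?differ h (2 * k) (2 * k + 1)) \<le> measure_pmf.expectation (?T h) (\<lambda>S. ?B S k)"
        if "k \<in> {..<N div 2}" for k
      proof -
        have k: "2 * k < N" "2 * k + 1 < N" using that by auto
        have ex: "measure_pmf.expectation (?T h) (\<lambda>S. ?B S k) =
          measure_pmf.prob (?T h) {S. 2 * k \<in> S \<and> 2 * k + 1 \<notin> S \<and> ?m (2 * k) < ?m (2 * k + 1)} +
          measure_pmf.prob (?T h) {S. 2 * k + 1 \<in> S \<and> 2 * k \<notin> S \<and> ?m (2 * k + 1) < ?m (2 * k)}"
          by (simp add: integrable_measure_pmf_finite fin expectation_of_bool del: of_bool_conj)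
        consider "?m (2 * k) < ?m (2 * k + 1)" | "?m (2 * k + 1) < ?m (2 * k)" | "?m (2 * k) = ?m (2 * k + 1)"
          by linarith
        then show ?thesis
          using sep[OF N _ h k(1,2)] sep[OF N _ h k(2,1)] unfolding ex by cases simp_all
      qed
      have "\<delta> * (\<Sum>k<N div 2. c * of_bool (?differ h (2 * k) (2 * k + 1)))
          \<le> \<delta> * (\<Sum>k<N div 2. measure_pmf.expectation (?T h) (\<lambda>S. ?B S k))"
        using \<delta> pair by (intro mult_left_mono sum_mono) auto
      also have "\<dots> = measure_pmf.expectation (?T h) (\<lambda>S. (\<Sum>k<N div 2. ?B S k) / (real (Suc t) + 2)\<^sup>2)"
        by (simp add: integrable_measure_pmf_finite fin \<delta>_def del: of_bool_conj of_nat_Suc)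
      also have "\<dots> \<le> measure_pmf.expectation (?T h) (regret N h)"
        using set_pmf_policy[OF adm, of h] regret_ge_misordered_pairs[OF _ h]
        by (intro expectation_mono_pmf fin) blast
      finally show ?thesis .
    qed
    have "\<delta> * c * (c * q) / 4 * real N = \<delta> * (real N / 4 * (c * (c * q)))" by simp
    also have "\<dots> \<le> \<delta> * (real (N div 2) * (c * (c * q)))"
      using \<delta> c q N by (intro mult_left_mono mult_right_mono) (auto simp: field_simps)
    also have "\<dots> = \<delta> * (\<Sum>k<N div 2. c * (c * q))" by simp
    also have "\<dots> \<le> \<delta> * (\<Sum>k<N div 2. c * measure_pmf.expectation (predictive ?T (Suc t))
        (\<lambda>h. of_bool (?differ h (2 * k) (2 * k + 1))))"
      using \<delta> c by (intro mult_left_mono sum_mono differ) auto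
    also have "\<dots> = measure_pmf.expectation (predictive ?T (Suc t))
        (\<lambda>h. \<delta> * (\<Sum>k<N div 2. c * of_bool (?differ h (2 * k) (2 * k + 1))))"
      by (simp add: integrable_measure_pmf_finite fin
          del: predictive.simps sum_of_bool_eq sum_mult_of_bool_eq sum_of_bool_mult_eq)
    also have "\<dots> \<le> measure_pmf.expectation (predictive ?T (Suc t))
        (\<lambda>h. measure_pmf.expectation (?T h) (regret N h))"
      using set_pmf_predictive[OF adm, of "Suc t"] regret by (intro expectation_mono_pmf fin) blast
    also have "\<dots> \<le> optimal_value (Suc (Suc t)) N - policy_value (Suc (Suc t)) N ?T"
      by (rule optimality_gap_ge_regret[OF adm])
    finally show "\<delta> * c * (c * q) / 4 * real N
        \<le> optimal_value (Suc (Suc t)) N - policy_value (Suc (Suc t)) N ?T" .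
  qed
qed

section \<open>The fluid limit of UCB\<close>

definition state_index :: "nat \<times> nat \<Rightarrow> real" where
  "state_index a = state_mean a
     + 1/2 * sqrt (state_mean a * (1 - state_mean a) / (real (fst a) + real (snd a) + 3))"

lemma ucb_index_state: "ucb_index h i = state_index (state h i)"
  by (simp add: ucb_index_def posterior_def mean_of_beta_measure sd_of_beta_measure state_index_def)

definition states :: "nat \<Rightarrow> (nat \<times> nat) set" where
  "states t = {a. fst a + snd a \<le> t}"

lemma finite_states: "finite (states t)"
  by (rule finite_subset[of _ "{..t} \<times> {..t}"]) (auto simp: states_def)

text \<open>
  The fraction of all arms that are in each state, or that are in it and pulled.
\<close>
type_synonym profile = "nat \<times> nat \<Rightarrow> real"

text \<open>
  The profile \<open>y\<close> of pulled arms is what UCB selects from \<open>x\<close>: a state may be left partly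
  unpulled only if every other pulled state has a strictly larger index. Strictness excludes a tie
  at the cut, where the numbers of pulled arms would depend on the way in which it is broken.
\<close>
definition fluid_choice :: "nat \<Rightarrow> profile \<Rightarrow> profile \<Rightarrow> bool" where
  "fluid_choice t x y \<longleftrightarrow>
     (\<forall>a. 0 \<le> y a \<and> y a \<le> x a) \<and> (\<forall>a. a \<notin> states t \<longrightarrow> x a = 0) \<and> (\<Sum>a\<in>states t. y a) = 1/3 \<and>
     (\<forall>a b. 0 < y a \<longrightarrow> y b < x b \<longrightarrow> a \<noteq> b \<longrightarrow> state_index b < state_index a)"

lemma fluid_choiceD:
  assumes "fluid_choice t x y"
  shows "0 \<le> y a" "y a \<le> x a" "a \<notin> states t \<Longrightarrow> x a = 0" "(\<Sum>a\<in>states t. y a) = 1/3"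
    "0 < y a \<Longrightarrow> y b < x b \<Longrightarrow> a \<noteq> b \<Longrightarrow> state_index b < state_index a"
  using assms unfolding fluid_choice_def by blast+

definition fluid_next :: "profile \<Rightarrow> profile \<Rightarrow> profile" where
  "fluid_next x y a = x a - y a
     + (case fst a of 0 \<Rightarrow> 0 | Suc s \<Rightarrow> state_mean (s, snd a) * y (s, snd a))
     + (case snd a of 0 \<Rightarrow> 0 | Suc f \<Rightarrow> (1 - state_mean (fst a, f)) * y (fst a, f))"

inductive fluid :: "nat \<Rightarrow> profile \<Rightarrow> bool" where
  fluid_0: "fluid 0 (\<lambda>a. of_bool (a = (0, 0)))"
| fluid_Suc: "fluid t x \<Longrightarrow> fluid_choice t x y \<Longrightarrow> fluid (Suc t) (fluid_next x y)"

definition arms_in :: "nat \<Rightarrow> history \<Rightarrow> nat \<times> nat \<Rightarrow> nat set" where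
  "arms_in N h a = {i. i < N \<and> state h i = a}"

definition discrepancy :: "nat \<Rightarrow> profile \<Rightarrow> nat \<Rightarrow> history \<Rightarrow> real" where
  "discrepancy t x N h = (\<Sum>a\<in>states t. \<bar>real (card (arms_in N h a)) - real N * x a\<bar>)"

lemma finite_arms_in: "finite (arms_in N h a)"
  by (simp add: arms_in_def)

lemma arms_in_empty:
  assumes "h \<in> histories N t" "a \<notin> states t"
  shows "arms_in N h a = {}"
  using assms state_sum_le[OF assms(1)] by (auto simp: arms_in_def states_def)

lemma discrepancy_nonneg: "0 \<le> discrepancy t x N h"
  by (simp add: discrepancy_def sum_nonneg)

lemma discrepancy_bounds:
  assumes "h \<in> histories N t" "fluid_choice t x y"
  shows "\<bar>real (card (arms_in N h a)) - real N * x a\<bar> \<le> discrepancy t x N h"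
proof (cases "a \<in> states t")
  case True
  then show ?thesis
    unfolding discrepancy_def by (intro member_le_sum) (auto simp: finite_states)
next
  case False
  then show ?thesis
    using arms_in_empty[OF assms(1) False] fluid_choiceD(3)[OF assms(2) False]
    by (simp add: discrepancy_nonneg)
qed

text \<open>
  If the deviations nearly sum up to 0, then a bound from above on all of them bounds them from below.
\<close>
lemma deviation_le_of_one_sided:
  fixes d :: "'a \<Rightarrow> real"
  assumes "finite A" "\<And>b. b \<in> A \<Longrightarrow> d b \<le> D" "0 \<le> D" "\<bar>\<Sum>b\<in>A. d b\<bar> \<le> 1" "a \<in> A"
  shows "\<bar>d a\<bar> \<le> real (card A) * D + 1"
proof -
  have "card A \<ge> 1" using assms(1,5) by (metis One_nat_def Suc_leI card_gt_0_iff empty_iff)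
  then have "1 * D \<le> real (card A) * D" using assms(3) by (intro mult_right_mono) auto
  moreover have "(\<Sum>b\<in>A - {a}. d b) \<le> real (card (A - {a})) * D"
    using assms(2) by (intro sum_bounded_above) auto
  moreover have "real (card (A - {a})) * D \<le> real (card A) * D"
    using assms by (intro mult_right_mono) (auto intro: card_mono)
  moreover have "(\<Sum>b\<in>A. d b) = d a + (\<Sum>b\<in>A - {a}. d b)"
    using assms by (simp add: sum.remove)
  ultimately show ?thesis using assms(2)[OF assms(5)] assms(4) by linarith
qed

text \<open>
  The selection depends on the state counts in a Lipschitz continuous way. The reason is that no state
  \<open>a\<close> can be pulled more often than the fluid by more than the discrepancy while another state \<open>b\<close> is
  pulled less often by more than the discrepancy: then \<open>b\<close> would be pulled in the fluid and \<open>a\<close> not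
  completely, so \<open>b\<close> would have the larger index; but an arm in state \<open>a\<close> is selected and one in state
  \<open>b\<close> is not, so \<open>a\<close> has at least the index of \<open>b\<close>. The total number pulled is \<open>N div 3\<close>, and hence the
  deviations nearly sum up to 0.
\<close>
lemma pulled_counts_near_fluid:
  assumes h: "h \<in> histories N t" and S: "top_selection N (ucb_index h) S" and xy: "fluid_choice t x y"
  shows "\<bar>real (card (S \<inter> arms_in N h a)) - real N * y a\<bar>
     \<le> real (card (states t)) * discrepancy t x N h + 1"
proof (cases "a \<in> states t")
  case False
  then have "x a = 0" "arms_in N h a = {}"
    using fluid_choiceD(3)[OF xy] arms_in_empty[OF h] by simp_all
  moreover have "y a = 0" using fluid_choiceD(1,2)[OF xy, of a] \<open>x a = 0\<close> by simp
  ultimately show ?thesis by (simp add: discrepancy_nonneg)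
next
  case True
  define D where "D = discrepancy t x N h"
  define d where "d = (\<lambda>a. real (card (S \<inter> arms_in N h a)) - real N * y a)"
  have D: "0 \<le> D" by (simp add: D_def discrepancy_nonneg)
  have X: "\<bar>real (card (arms_in N h a)) - real N * x a\<bar> \<le> D" for a
    unfolding D_def by (rule discrepancy_bounds[OF h xy])
  have Ssel: "S \<in> selections N" using S by (simp add: top_selection_def)
  have one_sided: "\<not> (D < d a \<and> D < - d b)" for a b
  proof
    assume ab: "D < d a \<and> D < - d b"
    have "0 < real N" using ab D by (cases "N = 0") (auto simp: d_def)
    have sub: "real (card (S \<inter> arms_in N h a)) \<le> real (card (arms_in N h a))" for a
      by (simp add: card_mono finite_arms_in)
    have yx: "0 \<le> y c" "y c \<le> x c" for c using fluid_choiceD[OF xy] by auto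
    have "real N * y a < real N * x a"
      using ab X[of a] sub[of a] unfolding d_def by linarith
    then have "y a < x a" using \<open>0 < real N\<close> by simp
    moreover have "0 < real N * y b" using ab D unfolding d_def by linarith
    then have "0 < y b" using \<open>0 < real N\<close> by (simp add: zero_less_mult_iff)
    moreover have "a \<noteq> b" using ab D by auto
    ultimately have "state_index a < state_index b"
      by (intro fluid_choiceD(5)[OF xy]) auto
    have "0 < real (card (S \<inter> arms_in N h a))"
      using ab D yx[of a] \<open>0 < real N\<close> unfolding d_def by (smt (verit) mult_nonneg_nonneg)
    then obtain i where i: "i \<in> S" "state h i = a"
      by (auto simp: card_gt_0_iff arms_in_def)
    have "real N * y b \<le> real N * x b" using yx \<open>0 < real N\<close> by simp
    then have "real (card (S \<inter> arms_in N h b)) < real (card (arms_in N h b))"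
      using ab X[of b] unfolding d_def by linarith
    then have "\<not> arms_in N h b \<subseteq> S"
      by (auto simp: Int_absorb1)
    then obtain j where j: "j < N" "j \<notin> S" "state h j = b"
      by (auto simp: arms_in_def)
    have "ucb_index h j \<le> ucb_index h i"
      using S i j by (auto simp: top_selection_def)
    with i j \<open>state_index a < state_index b\<close> show False
      by (simp add: ucb_index_state)
  qed
  have sum_d: "\<bar>\<Sum>b\<in>states t. d b\<bar> \<le> 1"
  proof -
    have "S = (\<Union>b\<in>states t. S \<inter> arms_in N h b)"
      using Ssel state_sum_le[OF h] by (auto simp: selections_def arms_in_def states_def)
    then have "card S = card (\<Union>b\<in>states t. S \<inter> arms_in N h b)" by simp
    also have "\<dots> = (\<Sum>b\<in>states t. card (S \<inter> arms_in N h b))"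
      by (intro card_UN_disjoint) (auto simp: finite_states finite_arms_in, auto simp: arms_in_def)
    finally have "(\<Sum>b\<in>states t. real (card (S \<inter> arms_in N h b))) = real (N div 3)"
      using Ssel by (simp add: selections_def flip: of_nat_sum)
    moreover have "(\<Sum>b\<in>states t. real N * y b) = real N / 3"
      using fluid_choiceD(4)[OF xy] by (simp flip: sum_distrib_left)
    ultimately have "(\<Sum>b\<in>states t. d b) = real (N div 3) - real N / 3"
      by (simp add: d_def sum_subtractf)
    moreover have "N = 3 * (N div 3) + N mod 3" "N mod 3 < 3" by auto
    then have "real N = 3 * real (N div 3) + real (N mod 3)" "real (N mod 3) < 3"
      by linarith+
    ultimately show ?thesis by linarith
  qed
  have "\<bar>d a\<bar> \<le> real (card (states t)) * D + 1"
  proof (cases "\<forall>b. d b \<le> D")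
    case True': True
    then show ?thesis
      using sum_d D True by (intro deviation_le_of_one_sided) (auto simp: finite_states)
  next
    case False
    then have "- d b \<le> D" for b using one_sided by (meson not_le)
    then have "\<bar>- d a\<bar> \<le> real (card (states t)) * D + 1"
      using sum_d D True
      by (intro deviation_le_of_one_sided) (auto simp: finite_states sum_negf)
    then show ?thesis by simp
  qed
  then show ?thesis by (simp add: d_def D_def)
qed

definition success_count :: "nat \<Rightarrow> history \<Rightarrow> nat set \<Rightarrow> (nat \<Rightarrow> bool) \<Rightarrow> nat \<times> nat \<Rightarrow> real" where
  "success_count N h S r b = real (card {i \<in> S \<inter> arms_in N h b. r i})"

text \<open>
  An arm is in state \<open>a\<close> after a period if it was in state \<open>a\<close> and not pulled, or if it was pulled in a
  neighbouring state and had the outcome that leads to \<open>a\<close>.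
\<close>
lemma card_arms_in_snoc:
  assumes "S \<in> selections N"
  shows "real (card (arms_in N (h @ [(S, r)]) a)) =
    real (card (arms_in N h a)) - real (card (S \<inter> arms_in N h a))
     + (case fst a of 0 \<Rightarrow> 0 | Suc s \<Rightarrow> success_count N h S r (s, snd a))
     + (case snd a of 0 \<Rightarrow> 0 | Suc f \<Rightarrow>
          real (card (S \<inter> arms_in N h (fst a, f))) - success_count N h S r (fst a, f))"
proof -
  define A where "A = arms_in N h a - S"
  define B where "B = (case fst a of 0 \<Rightarrow> {} | Suc s \<Rightarrow> {i \<in> S \<inter> arms_in N h (s, snd a). r i})"
  define C where "C = (case snd a of 0 \<Rightarrow> {} | Suc f \<Rightarrow> {i \<in> S \<inter> arms_in N h (fst a, f). \<not> r i})"
  have S: "S \<subseteq> {..<N}" "finite S" using assms finite_selection[OF assms] by (auto simp: selections_def)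
  have eq: "arms_in N (h @ [(S, r)]) a = A \<union> B \<union> C"
    using S unfolding A_def B_def C_def
    by (cases a) (auto simp: arms_in_def state_snoc split: nat.splits if_splits)
  have fin: "finite A" "finite B" "finite C"
    using S by (auto simp: A_def B_def C_def finite_arms_in split: nat.splits)
  have "card (A \<union> B \<union> C) = card (A \<union> B) + card C"
    by (rule card_Un_disjoint) (use fin in \<open>auto simp: A_def B_def C_def split: nat.splits\<close>)
  moreover have "card (A \<union> B) = card A + card B"
    by (rule card_Un_disjoint) (use fin in \<open>auto simp: A_def B_def split: nat.splits\<close>)
  moreover have "real (card A) = real (card (arms_in N h a)) - real (card (S \<inter> arms_in N h a))"
  proof -
    have "card (arms_in N h a) = card A + card (S \<inter> arms_in N h a)"
      unfolding A_def by (metis Int_commute add.commute card_Diff_subset_Int card_Int_Diff finite_arms_in)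
    then show ?thesis by simp
  qed
  moreover have "real (card B) = (case fst a of 0 \<Rightarrow> 0 | Suc s \<Rightarrow> success_count N h S r (s, snd a))"
    by (simp add: B_def success_count_def split: nat.splits)
  moreover have "real (card C) = (case snd a of 0 \<Rightarrow> 0 | Suc f \<Rightarrow>
          real (card (S \<inter> arms_in N h (fst a, f))) - success_count N h S r (fst a, f))"
  proof -
    have "real (card {i \<in> S \<inter> arms_in N h b. \<not> r i}) =
        real (card (S \<inter> arms_in N h b)) - success_count N h S r b" for b
    proof -
      let ?B = "S \<inter> arms_in N h b"
      have "card {i \<in> ?B. r i} + card {i \<in> ?B. \<not> r i} = card ({i \<in> ?B. r i} \<union> {i \<in> ?B. \<not> r i})"
        using S by (subst card_Un_disjoint) auto
      also have "{i \<in> ?B. r i} \<union> {i \<in> ?B. \<not> r i} = ?B" by auto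
      finally have "card ?B = card {i \<in> ?B. r i} + card {i \<in> ?B. \<not> r i}" by simp
      then show ?thesis by (simp add: success_count_def)
    qed
    then show ?thesis by (simp add: C_def split: nat.splits)
  qed
  ultimately show ?thesis unfolding eq by simp
qed

definition fluctuation :: "nat \<Rightarrow> nat \<Rightarrow> history \<Rightarrow> nat set \<Rightarrow> (nat \<Rightarrow> bool) \<Rightarrow> real" where
  "fluctuation t N h S r = (\<Sum>b\<in>states t.
     \<bar>success_count N h S r b - state_mean b * real (card (S \<inter> arms_in N h b))\<bar>)"

lemma discrepancy_snoc:
  assumes h: "h \<in> histories N t" and S: "top_selection N (ucb_index h) S" and xy: "fluid_choice t x y"
  defines "M \<equiv> \<lambda>t. real (card (states t))"
  shows "discrepancy (Suc t) (fluid_next x y) N (h @ [(S, r)]) \<le>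
    M (Suc t) * ((1 + 3 * M t) * discrepancy t x N h + 3 + 2 * fluctuation t N h S r)"
proof -
  have Ssel: "S \<in> selections N" using S by (simp add: top_selection_def)
  define D where "D = discrepancy t x N h"
  define F where "F = fluctuation t N h S r"
  let ?n = "\<lambda>a. real (card (S \<inter> arms_in N h a))"
  have D: "0 \<le> D" by (simp add: D_def discrepancy_nonneg)
  have F: "0 \<le> F" by (simp add: F_def fluctuation_def sum_nonneg)
  have M: "0 \<le> M t" by (simp add: M_def)
  have n: "\<bar>?n a - real N * y a\<bar> \<le> M t * D + 1" for a
    unfolding M_def D_def by (rule pulled_counts_near_fluid[OF h S xy])
  have R: "\<bar>success_count N h S r b - state_mean b * ?n b\<bar> \<le> F" if "b \<in> states t" for b
    unfolding F_def fluctuation_def using that by (intro member_le_sum) (auto simp: finite_states)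
  have mn: "\<bar>state_mean b * ?n b - state_mean b * (real N * y b)\<bar> \<le> M t * D + 1"
    "\<bar>(1 - state_mean b) * ?n b - (1 - state_mean b) * (real N * y b)\<bar> \<le> M t * D + 1" for b
  proof -
    have le: "p * \<bar>?n b - real N * y b\<bar> \<le> 1 * (M t * D + 1)" if "0 \<le> p" "p \<le> 1" for p
      using n[of b] that M D by (intro mult_mono) auto
    show "\<bar>state_mean b * ?n b - state_mean b * (real N * y b)\<bar> \<le> M t * D + 1"
      using le[of "state_mean b"] state_mean_bounds[of b]
      by (simp add: abs_mult flip: right_diff_distrib)
    show "\<bar>(1 - state_mean b) * ?n b - (1 - state_mean b) * (real N * y b)\<bar> \<le> M t * D + 1"
      using le[of "1 - state_mean b"] state_mean_bounds[of b]
      by (simp add: abs_mult flip: right_diff_distrib)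
  qed
  have a: "\<bar>real (card (arms_in N (h @ [(S, r)]) a)) - real N * fluid_next x y a\<bar>
      \<le> (1 + 3 * M t) * D + 3 + 2 * F" if "a \<in> states (Suc t)" for a
  proof -
    define u u' where "u = (case fst a of 0 \<Rightarrow> 0 | Suc s \<Rightarrow> success_count N h S r (s, snd a))"
      and "u' = (case fst a of 0 \<Rightarrow> 0 | Suc s \<Rightarrow> state_mean (s, snd a) * y (s, snd a))"
    define v v' where "v = (case snd a of 0 \<Rightarrow> 0 | Suc f \<Rightarrow>
          ?n (fst a, f) - success_count N h S r (fst a, f))"
      and "v' = (case snd a of 0 \<Rightarrow> 0 | Suc f \<Rightarrow> (1 - state_mean (fst a, f)) * y (fst a, f))"
    have MD: "0 \<le> M t * D" using M D by simp
    have u: "\<bar>u - real N * u'\<bar> \<le> F + M t * D + 1"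
    proof (cases "fst a")
      case (Suc s)
      then have "(s, snd a) \<in> states t" using that by (simp add: states_def)
      then show ?thesis
        using R[of "(s, snd a)"] mn(1)[of "(s, snd a)"] unfolding u_def u'_def Suc nat.case
        by (simp add: algebra_simps; linarith)
    qed (use MD F in \<open>simp add: u_def u'_def\<close>)
    have v: "\<bar>v - real N * v'\<bar> \<le> F + M t * D + 1"
    proof (cases "snd a")
      case (Suc f)
      then have "(fst a, f) \<in> states t" using that by (simp add: states_def)
      then show ?thesis
        using R[of "(fst a, f)"] mn(2)[of "(fst a, f)"] unfolding v_def v'_def Suc nat.case
        by (simp add: algebra_simps; linarith)
    qed (use MD F in \<open>simp add: v_def v'_def\<close>)
    have "\<bar>real (card (arms_in N h a)) - real N * x a\<bar> \<le> D"
      unfolding D_def by (rule discrepancy_bounds[OF h xy])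
    moreover have "real (card (arms_in N (h @ [(S, r)]) a)) = real (card (arms_in N h a)) - ?n a + u + v"
      unfolding card_arms_in_snoc[OF Ssel] u_def v_def by simp
    moreover have "real N * fluid_next x y a = real N * x a - real N * y a + real N * u' + real N * v'"
      unfolding fluid_next_def u'_def v'_def by (simp only: distrib_left right_diff_distrib)
    ultimately show ?thesis
      using u v n[of a] by (simp add: distrib_right; linarith)
  qed
  have "discrepancy (Suc t) (fluid_next x y) N (h @ [(S, r)])
      \<le> (\<Sum>a\<in>states (Suc t). (1 + 3 * M t) * D + 3 + 2 * F)"
    unfolding discrepancy_def by (intro sum_mono a)
  then show ?thesis by (simp add: M_def D_def F_def)
qed

text \<open>
  The centred outcomes are independent, so the second moment of their weighted sum is the sum of
  the second moments of its terms, each of which is at most \<open>(w i)\<^sup>2\<close>.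
\<close>
lemma expectation_square_sum_bernoulli:
  assumes "finite S" "\<And>i. i \<in> S \<Longrightarrow> 0 \<le> p i \<and> p i \<le> 1"
  shows "measure_pmf.expectation (Pi_pmf S False (\<lambda>i. bernoulli_pmf (p i)))
      (\<lambda>r. (\<Sum>i\<in>S. w i * (of_bool (r i) - p i))\<^sup>2) \<le> (\<Sum>i\<in>S. (w i)\<^sup>2 :: real)"
  using assms
proof (induction S rule: finite_induct)
  case (insert k S)
  let ?P = "Pi_pmf S False (\<lambda>i. bernoulli_pmf (p i))"
  let ?Z = "\<lambda>r. \<Sum>i\<in>S. w i * (of_bool (r i) - p i)"
  have fin: "finite (set_pmf ?P)" using insert by (intro finite_Pi_pmf_bool)
  have pk: "0 \<le> p k" "p k \<le> 1" using insert.prems by auto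
  define m1 m2 where "m1 = measure_pmf.expectation ?P ?Z"
    and "m2 = measure_pmf.expectation ?P (\<lambda>r. (?Z r)\<^sup>2)"
  have sq: "measure_pmf.expectation ?P (\<lambda>r. (c + ?Z r)\<^sup>2) = c\<^sup>2 + 2 * c * m1 + m2" for c
    by (simp add: power2_sum m1_def m2_def integrable_measure_pmf_finite[OF fin])
  have Z: "(\<Sum>i\<in>insert k S. w i * (of_bool ((r(k := b)) i) - p i)) = w k * (of_bool b - p k) + ?Z r" for r b
    using insert.hyps by (subst sum.insert) (auto intro!: sum.cong)
  have "measure_pmf.expectation (Pi_pmf (insert k S) False (\<lambda>i. bernoulli_pmf (p i)))
      (\<lambda>r. (\<Sum>i\<in>insert k S. w i * (of_bool (r i) - p i))\<^sup>2)
    = measure_pmf.expectation (bernoulli_pmf (p k)) (\<lambda>b. measure_pmf.expectation ?P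
        (\<lambda>r. (w k * (of_bool b - p k) + ?Z r)\<^sup>2))"
    unfolding Pi_pmf_insert'[OF insert.hyps(1,2)]
    by (simp add: expectation_bind_finite fin Z del: fun_upd_apply)
  also have "\<dots> = (w k)\<^sup>2 * (p k * (1 - p k)) + m2"
    unfolding sq using pk by (simp add: power2_eq_square algebra_simps)
  also have "\<dots> \<le> (w k)\<^sup>2 * 1 + (\<Sum>i\<in>S. (w i)\<^sup>2)"
    using insert pk unfolding m2_def by (intro add_mono mult_left_mono mult_le_one) auto
  finally show ?case using insert.hyps by simp
qed simp

text \<open>
  Each success count has variance at most \<open>N\<close>. This bounds its mean absolute deviation, since
  \<open>\<bar>z\<bar> \<le> z\<^sup>2 / (2 * sqrt N) + sqrt N / 2\<close>.
\<close>
lemma expectation_fluctuation: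
  assumes S: "S \<in> selections N" and N: "0 < N"
  shows "measure_pmf.expectation (Pi_pmf S False (\<lambda>i. bernoulli_pmf (state_mean (state h i))))
     (fluctuation t N h S) \<le> real (card (states t)) * sqrt (real N)"
proof -
  let ?P = "Pi_pmf S False (\<lambda>i. bernoulli_pmf (state_mean (state h i)))"
  have finS: "finite S" and SN: "card S \<le> N"
    using S finite_selection[OF S] by (auto simp: selections_def)
  have fin: "finite (set_pmf ?P)" using finS by (rule finite_Pi_pmf_bool)
  have b: "measure_pmf.expectation ?P
      (\<lambda>r. \<bar>success_count N h S r b - state_mean b * real (card (S \<inter> arms_in N h b))\<bar>) \<le> sqrt (real N)" for b
  proof -
    let ?w = "\<lambda>i. of_bool (i \<in> arms_in N h b) :: real"
    let ?Z = "\<lambda>r. \<Sum>i\<in>S. ?w i * (of_bool (r i) - state_mean (state h i))"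
    have Z: "success_count N h S r b - state_mean b * real (card (S \<inter> arms_in N h b)) = ?Z r" for r
    proof -
      have "?Z r = (\<Sum>i\<in>S. of_bool (i \<in> arms_in N h b \<and> r i) - state_mean b * ?w i)"
        by (intro sum.cong) (auto simp: arms_in_def)
      also have "\<dots> = success_count N h S r b - state_mean b * real (card (S \<inter> arms_in N h b))"
        using finS by (simp add: sum_subtractf success_count_def Int_def conj_assoc
            flip: sum_distrib_left)
      finally show ?thesis by simp
    qed
    have s: "0 < sqrt (real N)" using N by simp
    have "\<bar>z\<bar> \<le> z\<^sup>2 / (2 * sqrt (real N)) + sqrt (real N) / 2" for z :: real
    proof -
      have "0 \<le> (\<bar>z\<bar> - sqrt (real N))\<^sup>2" by simp
      then show ?thesis
        using s by (simp add: power2_diff field_simps power2_eq_square)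
    qed
    then have "measure_pmf.expectation ?P (\<lambda>r. \<bar>?Z r\<bar>)
        \<le> measure_pmf.expectation ?P (\<lambda>r. (?Z r)\<^sup>2 / (2 * sqrt (real N)) + sqrt (real N) / 2)"
      by (intro expectation_mono_pmf fin)
    also have "\<dots> = measure_pmf.expectation ?P (\<lambda>r. (?Z r)\<^sup>2) / (2 * sqrt (real N)) + sqrt (real N) / 2"
      by (simp add: integrable_measure_pmf_finite[OF fin])
    also have "\<dots> \<le> real N / (2 * sqrt (real N)) + sqrt (real N) / 2"
    proof -
      have "measure_pmf.expectation ?P (\<lambda>r. (?Z r)\<^sup>2) \<le> (\<Sum>i\<in>S. (?w i)\<^sup>2)"
        using state_mean_bounds by (intro expectation_square_sum_bernoulli finS) (auto intro: less_imp_le)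
      also have "\<dots> \<le> (\<Sum>i\<in>S. 1)" by (intro sum_mono) auto
      finally have "measure_pmf.expectation ?P (\<lambda>r. (?Z r)\<^sup>2) \<le> real N" using SN by simp
      then show ?thesis using s by (intro add_right_mono divide_right_mono) auto
    qed
    also have "\<dots> = sqrt (real N)"
      using s by (simp add: field_simps)
    finally show ?thesis by (simp add: Z)
  qed
  have "measure_pmf.expectation ?P (fluctuation t N h S) = (\<Sum>b\<in>states t. measure_pmf.expectation ?P
      (\<lambda>r. \<bar>success_count N h S r b - state_mean b * real (card (S \<inter> arms_in N h b))\<bar>))"
    unfolding fluctuation_def by (simp add: integrable_measure_pmf_finite[OF fin])
  also have "\<dots> \<le> (\<Sum>b\<in>states t. sqrt (real N))" by (intro sum_mono b)
  finally show ?thesis by simp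
qed

text \<open>
  The constant \<open>C\<close> depends on the period but on neither \<open>N\<close> nor the way in which ties are broken. The
  error is multiplied by a constant in each period, and the fluctuations add a multiple of \<open>sqrt N\<close>.
\<close>
theorem ucb_converges_to_fluid:
  assumes "fluid t x"
  shows "\<exists>C\<ge>0. \<forall>N>0. \<forall>\<pi>. is_ucb N \<pi> \<longrightarrow>
     measure_pmf.expectation (predictive \<pi> t) (discrepancy t x N) \<le> C * sqrt (real N)"
  using assms
proof (induction rule: fluid.induct)
  case fluid_0
  have "discrepancy 0 (\<lambda>a. of_bool (a = (0, 0))) N [] = 0" for N
  proof -
    have "states 0 = {(0, 0)}" by (auto simp: states_def)
    moreover have "arms_in N [] (0, 0) = {..<N}"
      by (auto simp: arms_in_def successes_def failures_def)
    ultimately show ?thesis by (simp add: discrepancy_def)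
  qed
  then show ?case by (intro exI[of _ 0]) simp
next
  case (fluid_Suc t x y)
  then obtain C where C: "0 \<le> C" and IH: "\<And>N \<pi>. 0 < N \<Longrightarrow> is_ucb N \<pi> \<Longrightarrow>
      measure_pmf.expectation (predictive \<pi> t) (discrepancy t x N) \<le> C * sqrt (real N)"
    by blast
  let ?M = "\<lambda>t. real (card (states t))"
  let ?C = "?M (Suc t) * ((1 + 3 * ?M t) * C + 3 + 2 * ?M t)"
  show ?case
  proof (intro exI[of _ ?C] conjI allI impI)
    show "0 \<le> ?C" using C by simp
    fix N :: nat and \<pi> assume N: "0 < N" and ucb: "is_ucb N \<pi>"
    note adm = is_ucb_imp_admissible[OF ucb]
    note fin = finite_predictive[OF adm] finite_policy[OF adm]
    let ?p = "\<lambda>h S. Pi_pmf S False (\<lambda>i. bernoulli_pmf (state_mean (state h i)))"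
    have s: "1 \<le> sqrt (real N)" using N by simp
    have step: "measure_pmf.expectation (?p h S)
         (\<lambda>r. discrepancy (Suc t) (fluid_next x y) N (h @ [(S, r)])) \<le>
        ?M (Suc t) * ((1 + 3 * ?M t) * discrepancy t x N h + (3 + 2 * ?M t) * sqrt (real N))"
      if h: "h \<in> histories N t" and S: "S \<in> set_pmf (\<pi> h)" for h S
    proof -
      have top: "top_selection N (ucb_index h) S" using ucb S by (simp add: is_ucb_def)
      then have Ssel: "S \<in> selections N" by (simp add: top_selection_def)
      have finp: "finite (set_pmf (?p h S))"
        using finite_selection[OF Ssel] by (rule finite_Pi_pmf_bool)
      have "measure_pmf.expectation (?p h S)
         (\<lambda>r. discrepancy (Suc t) (fluid_next x y) N (h @ [(S, r)]))
        \<le> measure_pmf.expectation (?p h S) (\<lambda>r. ?M (Suc t) *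
            ((1 + 3 * ?M t) * discrepancy t x N h + 3 + 2 * fluctuation t N h S r))"
        using discrepancy_snoc[OF h top fluid_Suc.hyps(2)] by (intro expectation_mono_pmf finp)
      also have "\<dots> = ?M (Suc t) * ((1 + 3 * ?M t) * discrepancy t x N h + 3 +
          2 * measure_pmf.expectation (?p h S) (fluctuation t N h S))"
        by (simp add: integrable_measure_pmf_finite[OF finp])
      also have "\<dots> \<le> ?M (Suc t) * ((1 + 3 * ?M t) * discrepancy t x N h + 3 * sqrt (real N) +
          2 * (?M t * sqrt (real N)))"
        using expectation_fluctuation[OF Ssel N] s
        by (intro mult_left_mono add_mono) auto
      finally show ?thesis by (simp add: algebra_simps)
    qed
    have "measure_pmf.expectation (predictive \<pi> (Suc t)) (discrepancy (Suc t) (fluid_next x y) N)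
      \<le> measure_pmf.expectation (predictive \<pi> t) (\<lambda>h. measure_pmf.expectation (\<pi> h) (\<lambda>S.
          ?M (Suc t) * ((1 + 3 * ?M t) * discrepancy t x N h + (3 + 2 * ?M t) * sqrt (real N))))"
      unfolding expectation_predictive_Suc[OF adm]
      using set_pmf_predictive[OF adm, of t] step by (intro expectation_mono_pmf fin) blast
    also have "\<dots> = ?M (Suc t) * ((1 + 3 * ?M t) * measure_pmf.expectation (predictive \<pi> t) (discrepancy t x N)
        + (3 + 2 * ?M t) * sqrt (real N))"
      by (simp add: integrable_measure_pmf_finite fin)
    also have "\<dots> \<le> ?M (Suc t) * ((1 + 3 * ?M t) * (C * sqrt (real N)) + (3 + 2 * ?M t) * sqrt (real N))"
      using IH[OF N ucb] by (intro mult_left_mono add_right_mono) auto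
    also have "\<dots> = ?C * sqrt (real N)" by (simp add: algebra_simps)
    finally show "measure_pmf.expectation (predictive \<pi> (Suc t)) (discrepancy (Suc t) (fluid_next x y) N)
      \<le> ?C * sqrt (real N)" .
  qed
qed

lemma regret_ge_inversion:
  assumes S: "S \<in> selections N"
  shows "(state_mean b - state_mean a) *
      real (min (card (S \<inter> arms_in N h a)) (card (arms_in N h b - S))) \<le> regret N h S"
proof -
  define m where "m = min (card (S \<inter> arms_in N h a)) (card (arms_in N h b - S))"
  have m: "m \<le> card (S \<inter> arms_in N h a)" "m \<le> card (arms_in N h b - S)"
    by (simp_all add: m_def)
  obtain P where P: "P \<subseteq> S \<inter> arms_in N h a" "card P = m"
    using obtain_subset_with_card_n[OF m(1)] by blast
  obtain P' where P': "P' \<subseteq> arms_in N h b - S" "card P' = m"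
    using obtain_subset_with_card_n[OF m(2)] by blast
  have "finite P" "finite P'"
    using finite_subset[OF P(1)] finite_subset[OF P'(1)] by (simp_all add: finite_arms_in)
  then obtain \<sigma> where \<sigma>: "bij_betw \<sigma> P P'"
    using P(2) P'(2) finite_same_card_bij[of P P'] by auto
  have img: "\<sigma> i \<in> arms_in N h b - S" if "i \<in> P" for i
    using that bij_betwE[OF \<sigma>] P' by blast
  have "(state_mean b - state_mean a) * real (card P) \<le> regret N h S"
  proof (rule regret_ge_exchange[OF S])
    show "inj_on \<sigma> P" using \<sigma> by (rule bij_betw_imp_inj_on)
    show "\<sigma> ` P \<subseteq> {..<N} - S" using img by (auto simp: arms_in_def)
    show "state_mean (state h i) + (state_mean b - state_mean a) \<le> state_mean (state h (\<sigma> i))"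
      if "i \<in> P" for i
      using that P img[OF that] by (auto simp: arms_in_def)
  qed (use P in auto)
  then show ?thesis by (simp only: P(2) m_def)
qed

text \<open>
  In expectation, about \<open>N * y a\<close> arms in state \<open>a\<close> are pulled and about \<open>N * (x b - y b)\<close> arms in the
  better state \<open>b\<close> are not, with errors of order \<open>sqrt N\<close>; exchanging them gains a linear amount.
\<close>
theorem ucb_gap_linear:
  assumes x: "fluid t x" and xy: "fluid_choice t x y"
    and a: "0 < y a" and b: "y b < x b" and ab: "state_mean a < state_mean b"
  shows "\<exists>c>0. \<forall>\<^sub>F N in sequentially. \<forall>\<pi>. is_ucb N \<pi> \<longrightarrow>
    c * real N \<le> optimal_value (Suc t) N - policy_value (Suc t) N \<pi>"
proof -
  obtain C where C: "0 \<le> C" and conv: "\<And>N \<pi>. 0 < N \<Longrightarrow> is_ucb N \<pi> \<Longrightarrow>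
      measure_pmf.expectation (predictive \<pi> t) (discrepancy t x N) \<le> C * sqrt (real N)"
    using ucb_converges_to_fluid[OF x] by blast
  define M where "M = real (card (states t))"
  define \<kappa> where "\<kappa> = min (y a) (x b - y b)"
  define \<delta> where "\<delta> = state_mean b - state_mean a"
  define K where "K = (M + 1) * C"
  have pos: "0 < \<kappa>" "0 < \<delta>" "0 \<le> M" "0 \<le> K" using a b ab C by (auto simp: \<kappa>_def \<delta>_def M_def K_def)
  have gap: "\<delta> * (real N * \<kappa> - K * sqrt (real N) - 1) \<le> optimal_value (Suc t) N - policy_value (Suc t) N \<pi>"
    if N: "0 < N" and ucb: "is_ucb N \<pi>" for N \<pi>
  proof -
    note adm = is_ucb_imp_admissible[OF ucb]
    note fin = finite_predictive[OF adm] finite_policy[OF adm]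
    have reg: "\<delta> * (real N * \<kappa> - (M + 1) * discrepancy t x N h - 1) \<le> regret N h S"
      if h: "h \<in> histories N t" and S: "S \<in> set_pmf (\<pi> h)" for h S
    proof -
      have top: "top_selection N (ucb_index h) S" using ucb S by (simp add: is_ucb_def)
      then have Ssel: "S \<in> selections N" by (simp add: top_selection_def)
      let ?D = "discrepancy t x N h"
      have D: "0 \<le> ?D" by (rule discrepancy_nonneg)
      note n = pulled_counts_near_fluid[OF h top xy, folded M_def]
      have "real N * \<kappa> - (M + 1) * ?D - 1 \<le> real (card (S \<inter> arms_in N h a))"
      proof -
        have "real N * \<kappa> \<le> real N * y a" by (intro mult_left_mono) (auto simp: \<kappa>_def)
        then show ?thesis using n[of a] D by (simp add: distrib_right; linarith)
      qed
      moreover have "real N * \<kappa> - (M + 1) * ?D - 1 \<le> real (card (arms_in N h b - S))"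
      proof -
        have "card (arms_in N h b) = card (S \<inter> arms_in N h b) + card (arms_in N h b - S)"
          by (metis Int_commute card_Int_Diff finite_arms_in)
        moreover have "real N * \<kappa> \<le> real N * (x b - y b)" by (intro mult_left_mono) (auto simp: \<kappa>_def)
        ultimately show ?thesis
          using n[of b] discrepancy_bounds[OF h xy, of b] D
          by (simp add: distrib_right right_diff_distrib; linarith)
      qed
      ultimately have "real N * \<kappa> - (M + 1) * ?D - 1
          \<le> real (min (card (S \<inter> arms_in N h a)) (card (arms_in N h b - S)))"
        by (simp add: min_def)
      then have "\<delta> * (real N * \<kappa> - (M + 1) * ?D - 1)
          \<le> \<delta> * real (min (card (S \<inter> arms_in N h a)) (card (arms_in N h b - S)))"
        using pos by (intro mult_left_mono) auto
      also have "\<dots> \<le> regret N h S"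
        unfolding \<delta>_def by (rule regret_ge_inversion[OF Ssel])
      finally show ?thesis .
    qed
    have "\<delta> * (real N * \<kappa> - K * sqrt (real N) - 1)
        \<le> \<delta> * (real N * \<kappa> - (M + 1) * measure_pmf.expectation (predictive \<pi> t) (discrepancy t x N) - 1)"
      unfolding K_def mult.assoc using conv[OF N ucb] pos by (intro mult_left_mono diff_mono) auto
    also have "\<dots> = measure_pmf.expectation (predictive \<pi> t) (\<lambda>h. measure_pmf.expectation (\<pi> h)
        (\<lambda>S. \<delta> * (real N * \<kappa> - (M + 1) * discrepancy t x N h - 1)))"
      by (simp add: integrable_measure_pmf_finite fin)
    also have "\<dots> \<le> measure_pmf.expectation (predictive \<pi> t) (\<lambda>h. measure_pmf.expectation (\<pi> h) (regret N h))"
      using set_pmf_predictive[OF adm, of t] reg by (intro expectation_mono_pmf fin) blast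
    also have "\<dots> \<le> optimal_value (Suc t) N - policy_value (Suc t) N \<pi>"
      by (rule optimality_gap_ge_regret[OF adm])
    finally show ?thesis .
  qed
  obtain N0 :: nat where N0: "(4 * K / \<kappa>)\<^sup>2 + 4 / \<kappa> + 1 \<le> real N0"
    using real_arch_simple by blast
  have "\<delta> * \<kappa> / 2 * real N \<le> optimal_value (Suc t) N - policy_value (Suc t) N \<pi>"
    if N: "N0 \<le> N" and ucb: "is_ucb N \<pi>" for N \<pi>
  proof -
    have le: "(4 * K / \<kappa>)\<^sup>2 + 4 / \<kappa> + 1 \<le> real N" using N0 N by linarith
    have nn: "0 \<le> (4 * K / \<kappa>)\<^sup>2" "0 < 4 / \<kappa>" using pos by auto
    have "0 < N" using le nn by (cases "N = 0") auto
    have "(4 * K / \<kappa>)\<^sup>2 \<le> real N" using le nn by linarith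
    then have "4 * K / \<kappa> \<le> sqrt (real N)" by (rule real_le_rsqrt)
    then have "K \<le> \<kappa> / 4 * sqrt (real N)" using pos by (simp add: field_simps)
    then have "K * sqrt (real N) \<le> \<kappa> / 4 * sqrt (real N) * sqrt (real N)"
      by (intro mult_right_mono) auto
    then have "K * sqrt (real N) \<le> \<kappa> / 4 * real N" by (simp add: mult.assoc)
    moreover have "4 / \<kappa> \<le> real N" using le nn by linarith
    then have "1 \<le> \<kappa> / 4 * real N" using pos by (simp add: field_simps)
    ultimately have "\<kappa> / 2 * real N \<le> real N * \<kappa> - K * sqrt (real N) - 1" by (simp add: field_simps)
    then have "\<delta> * (\<kappa> / 2 * real N) \<le> \<delta> * (real N * \<kappa> - K * sqrt (real N) - 1)"
      using pos by (intro mult_left_mono) auto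
    with gap[OF \<open>0 < N\<close> ucb] show ?thesis by simp
  qed
  then show ?thesis
    using pos by (intro exI[of _ "\<delta> * \<kappa> / 2"] conjI eventually_sequentiallyI[of N0]) auto
qed

section \<open>Exact computation of the fluid limit\<close>

text \<open>
  All sequences of outcomes with the same numbers of successes and failures are equally likely. So the
  fraction of arms in a state is the probability \<open>sequence_prob\<close> of one such sequence times a weight,
  which counts the sequences, each with the proportion that is pulled that far and no further.
  A pull passes the weight of a sequence on to both of its extensions. In terms of weights, the fluid
  recursion therefore consists of additions and subtractions only, and the common denominator
  \<open>mass_unit\<close> makes all weights integers. A grid stores them; its rows are indexed by the number of
  failures, its columns by the number of successes, and entries outside count as 0.
\<close>
type_synonym grid = "int list list"

definition cell :: "grid \<Rightarrow> nat \<times> nat \<Rightarrow> int" where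
  "cell G a = nth_default 0 (nth_default [] G (snd a)) (fst a)"

primrec imap :: "(nat \<Rightarrow> 'a \<Rightarrow> 'b) \<Rightarrow> nat \<Rightarrow> 'a list \<Rightarrow> 'b list" where
  "imap g k [] = []"
| "imap g k (x # xs) = g k x # imap g (Suc k) xs"

fun zip_pad :: "('a \<Rightarrow> 'a \<Rightarrow> 'a) \<Rightarrow> 'a list \<Rightarrow> 'a list \<Rightarrow> 'a list" where
  "zip_pad g [] ys = ys"
| "zip_pad g xs [] = xs"
| "zip_pad g (x # xs) (y # ys) = g x y # zip_pad g xs ys"

definition grid_add :: "grid \<Rightarrow> grid \<Rightarrow> grid" where
  "grid_add = zip_pad (zip_pad (+))"

definition grid_map :: "(nat \<times> nat \<Rightarrow> int \<Rightarrow> int) \<Rightarrow> grid \<Rightarrow> grid" where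
  "grid_map g = imap (\<lambda>f. imap (\<lambda>s. g (s, f)) 0) 0"

definition grid_sum :: "(nat \<times> nat \<Rightarrow> int \<Rightarrow> int) \<Rightarrow> grid \<Rightarrow> int" where
  "grid_sum g G = sum_list (imap (\<lambda>f row. sum_list (imap (\<lambda>s. g (s, f)) 0 row)) 0 G)"

definition grid_all :: "(nat \<times> nat \<Rightarrow> int \<Rightarrow> bool) \<Rightarrow> grid \<Rightarrow> bool" where
  "grid_all P G \<longleftrightarrow> list_all id (imap (\<lambda>f row. list_all id (imap (\<lambda>s. P (s, f)) 0 row)) 0 G)"

definition grid_next :: "grid \<Rightarrow> grid \<Rightarrow> grid" where
  "grid_next W Y = grid_add (grid_add W (map (map uminus) Y)) (grid_add (map (Cons 0) Y) ([] # Y))"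

lemma length_imap [simp]: "length (imap g k xs) = length xs"
  by (induction xs arbitrary: k) auto

lemma nth_imap: "i < length xs \<Longrightarrow> imap g k xs ! i = g (k + i) (xs ! i)"
  by (induction xs arbitrary: k i) (auto simp: nth_Cons split: nat.splits)

lemma cell_in_range: "f < length G \<Longrightarrow> s < length (G ! f) \<Longrightarrow> cell G (s, f) = G ! f ! s"
  by (simp add: cell_def nth_default_nth)

lemma cell_out_of_range: "\<not> (f < length G \<and> s < length (G ! f)) \<Longrightarrow> cell G (s, f) = 0"
  by (auto simp: cell_def nth_default_def)

lemma nth_default_zip_pad:
  assumes "\<And>x. g z x = x" "\<And>x. g x z = x"
  shows "nth_default z (zip_pad g xs ys) i = g (nth_default z xs i) (nth_default z ys i)"
  using assms
proof (induction g xs ys arbitrary: i rule: zip_pad.induct)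
  case (3 g x xs y ys)
  then show ?case by (cases i) simp_all
qed simp_all

lemma cell_add: "cell (grid_add G H) a = cell G a + cell H a"
proof -
  have "zip_pad (+) xs [] = xs" for xs :: "int list" by (cases xs) auto
  then show ?thesis
    by (simp add: cell_def grid_add_def nth_default_zip_pad)
qed

lemma cell_map:
  assumes "g a 0 = 0"
  shows "cell (grid_map g G) a = g a (cell G a)"
proof (cases a)
  case (Pair s f)
  show ?thesis
  proof (cases "f < length G \<and> s < length (G ! f)")
    case True
    then show ?thesis by (simp add: Pair grid_map_def cell_in_range nth_imap)
  next
    case False
    then have "\<not> (f < length (grid_map g G) \<and> s < length (grid_map g G ! f))"
      by (auto simp: grid_map_def nth_imap)
    then show ?thesis using False assms by (simp add: Pair cell_out_of_range)
  qed
qed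

lemma cell_all:
  assumes "grid_all P G" "P a 0"
  shows "P a (cell G a)"
proof (cases a)
  case (Pair s f)
  show ?thesis
  proof (cases "f < length G \<and> s < length (G ! f)")
    case True
    then show ?thesis using assms(1)
      by (auto simp: Pair grid_all_def cell_in_range list_all_length nth_imap)
  next
    case False
    then show ?thesis using assms(2) by (simp add: Pair cell_out_of_range)
  qed
qed

lemma grid_sum_eq:
  assumes "finite A" "\<And>a. g a 0 = 0" "\<And>a. a \<notin> A \<Longrightarrow> g a (cell G a) = 0"
  shows "grid_sum g G = (\<Sum>a\<in>A. g a (cell G a))"
proof -
  let ?R = "SIGMA f:{..<length G}. {..<length (G ! f)}"
  have "grid_sum g G = (\<Sum>f<length G. \<Sum>s<length (G ! f). g (s, f) (G ! f ! s))"
    by (simp add: grid_sum_def sum_list_sum_nth nth_imap atLeast0LessThan)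
  also have "\<dots> = (\<Sum>(f, s)\<in>?R. g (s, f) (cell G (s, f)))"
    by (subst sum.Sigma) (auto intro!: sum.cong simp: cell_in_range)
  also have "\<dots> = (\<Sum>a\<in>prod.swap ` ?R. g a (cell G a))"
    by (subst sum.reindex) (auto simp: case_prod_unfold prod.swap_def)
  also have "\<dots> = (\<Sum>a\<in>A. g a (cell G a))"
  proof (intro sum.mono_neutral_cong ballI)
    fix a assume "a \<in> A - prod.swap ` ?R"
    then have "\<not> (snd a < length G \<and> fst a < length (G ! snd a))"
      by (auto simp: image_iff) (metis (no_types) SigmaI lessThan_iff prod.collapse swap_simp)
    then show "g a (cell G a) = 0"
      using cell_out_of_range[of "snd a" G "fst a"] assms(2) by simp
  qed (use assms in auto)
  finally show ?thesis .
qed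

lemma cell_shift: "cell (map (Cons 0) G) (s, f) = (case s of 0 \<Rightarrow> 0 | Suc s' \<Rightarrow> cell G (s', f))"
  "cell ([] # G) (s, f) = (case f of 0 \<Rightarrow> 0 | Suc f' \<Rightarrow> cell G (s, f'))"
  by (auto simp: cell_def nth_default_def split: nat.splits)

lemma cell_uminus: "cell (map (map uminus) G) a = - cell G a"
  by (auto simp: cell_def nth_default_def)

lemma cell_next: "cell (grid_next W Y) (s, f) = cell W (s, f) - cell Y (s, f)
    + (case s of 0 \<Rightarrow> 0 | Suc s' \<Rightarrow> cell Y (s', f)) + (case f of 0 \<Rightarrow> 0 | Suc f' \<Rightarrow> cell Y (s, f'))"
  by (simp add: grid_next_def cell_add cell_shift cell_uminus)

text \<open>
  The least common denominator of all weights that occur in the first 20 periods.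
\<close>
definition mass_unit :: int where "mass_unit = 887882519338214400000"

definition profile_of :: "grid \<Rightarrow> profile" where
  "profile_of W a = of_int (cell W a) / of_int mass_unit * sequence_prob a"

lemma fluid_next_profile_of: "fluid_next (profile_of W) (profile_of Y) = profile_of (grid_next W Y)"
proof
  fix a :: "nat \<times> nat"
  obtain s f where a: "a = (s, f)" by (cases a)
  have 1: "(case s of 0 \<Rightarrow> 0 | Suc s' \<Rightarrow> state_mean (s', f) * profile_of Y (s', f)) =
      of_int (case s of 0 \<Rightarrow> 0 | Suc s' \<Rightarrow> cell Y (s', f)) / of_int mass_unit * sequence_prob (s, f)"
    by (cases s) (simp_all add: profile_of_def sequence_prob_Suc)
  have 2: "(case f of 0 \<Rightarrow> 0 | Suc f' \<Rightarrow> (1 - state_mean (s, f')) * profile_of Y (s, f')) =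
      of_int (case f of 0 \<Rightarrow> 0 | Suc f' \<Rightarrow> cell Y (s, f')) / of_int mass_unit * sequence_prob (s, f)"
    by (cases f) (simp_all add: profile_of_def sequence_prob_Suc)
  show "fluid_next (profile_of W) (profile_of Y) a = profile_of (grid_next W Y) a"
    unfolding a fluid_next_def fst_conv snd_conv 1 2
    by (simp only: profile_of_def cell_next of_int_add of_int_diff)
       (simp add: add_divide_distrib diff_divide_distrib distrib_right left_diff_distrib)
qed

lemma fluid_outside: "fluid t x \<Longrightarrow> a \<notin> states t \<Longrightarrow> x a = 0"
proof (induction arbitrary: a rule: fluid.induct)
  case (fluid_Suc t x y)
  have zero: "x b = 0 \<and> y b = 0" if "b \<notin> states t" for b
    using fluid_Suc.IH[OF that] fluid_choiceD(1,2)[OF fluid_Suc.hyps(2), of b] by simp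
  show ?case
    using fluid_Suc.prems zero
    by (cases a) (auto simp: fluid_next_def states_def split: nat.splits)
qed (auto simp: states_def)

text \<open>
  Sufficient conditions in integers for the index of a state to be larger, respectively smaller, than
  \<open>c / 1000\<close>. With mean \<open>m\<close> and variance \<open>v\<close>, the index exceeds \<open>q\<close> if \<open>q < m\<close> or \<open>4 * (q - m)\<^sup>2 < v\<close>,
  and it is smaller than \<open>q\<close> if \<open>m < q\<close> and \<open>v < 4 * (q - m)\<^sup>2\<close>.
\<close>
definition index_gt :: "int \<Rightarrow> nat \<times> nat \<Rightarrow> bool" where
  "index_gt c a \<longleftrightarrow>
     c * int (fst a + snd a + 2) < 1000 * int (fst a + 1) \<or>
     4 * (c * int (fst a + snd a + 2) - 1000 * int (fst a + 1))\<^sup>2 * int (fst a + snd a + 3)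
       < 1000000 * int ((fst a + 1) * (snd a + 1))"

definition index_lt :: "int \<Rightarrow> nat \<times> nat \<Rightarrow> bool" where
  "index_lt c a \<longleftrightarrow>
     1000 * int (fst a + 1) < c * int (fst a + snd a + 2) \<and>
     1000000 * int ((fst a + 1) * (snd a + 1))
       < 4 * (c * int (fst a + snd a + 2) - 1000 * int (fst a + 1))\<^sup>2 * int (fst a + snd a + 3)"

lemma index_tests:
  "index_gt c a \<Longrightarrow> of_int c / 1000 < state_index a"
  "index_lt c a \<Longrightarrow> state_index a < of_int c / 1000"
proof -
  obtain s f where a: "a = (s, f)" by (cases a)
  define n where "n = real s + real f + 2"
  define v where "v = (real s + 1) * (real f + 1) / (n\<^sup>2 * (n + 1))"
  define e where "e = of_int c / 1000 - state_mean a"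
  have n: "0 < n" by (simp add: n_def add_nonneg_pos)
  have m: "state_mean a = (real s + 1) / n" by (simp add: a state_mean_def n_def)
  have "1 - state_mean a = (real f + 1) / n" using n unfolding m by (simp add: field_simps) (simp add: n_def)
  then have idx: "state_index a = state_mean a + 1/2 * sqrt v"
    using m by (simp add: state_index_def a v_def n_def power2_eq_square add.assoc)
  define d where "d = of_int c * n - 1000 * (real s + 1)"
  have e: "e = d / (1000 * n)"
    using n unfolding e_def m d_def by (simp add: field_simps)
  have v: "0 \<le> v" using n by (simp add: v_def)
  have int_d: "of_int (c * int (s + f + 2) - 1000 * int (s + 1)) = d"
    by (simp add: d_def n_def add.assoc)
  have e4: "(2 * e)\<^sup>2 = 4 * d\<^sup>2 * (n + 1) / (1000000 * n\<^sup>2 * (n + 1))"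
    using n unfolding e by (simp add: power_mult_distrib power_divide)
  have v6: "v = 1000000 * ((real s + 1) * (real f + 1)) / (1000000 * n\<^sup>2 * (n + 1))"
    using n by (simp add: v_def)
  have den: "0 < 1000000 * n\<^sup>2 * (n + 1)" using n by simp
  have int_l: "of_int (4 * (c * int (s + f + 2) - 1000 * int (s + 1))\<^sup>2 * int (s + f + 3)) = 4 * d\<^sup>2 * (n + 1)"
    unfolding of_int_mult of_int_power int_d by (simp add: n_def)
  have int_r: "of_int (1000000 * int ((s + 1) * (f + 1))) = 1000000 * ((real s + 1) * (real f + 1))"
    by (simp add: algebra_simps)
  have cmp: "(2 * e)\<^sup>2 < v" if "4 * (c * int (s + f + 2) - 1000 * int (s + 1))\<^sup>2 * int (s + f + 3)
       < 1000000 * int ((s + 1) * (f + 1))"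
  proof -
    have "4 * d\<^sup>2 * (n + 1) < 1000000 * ((real s + 1) * (real f + 1))"
      using that unfolding int_l[symmetric] int_r[symmetric] by (simp only: of_int_less_iff)
    then show ?thesis unfolding e4 v6 using den by (rule divide_strict_right_mono)
  qed
  have cmp': "v < (2 * e)\<^sup>2" if "1000000 * int ((s + 1) * (f + 1))
      < 4 * (c * int (s + f + 2) - 1000 * int (s + 1))\<^sup>2 * int (s + f + 3)"
  proof -
    have "1000000 * ((real s + 1) * (real f + 1)) < 4 * d\<^sup>2 * (n + 1)"
      using that unfolding int_l[symmetric] int_r[symmetric] by (simp only: of_int_less_iff)
    then show ?thesis unfolding e4 v6 using den by (rule divide_strict_right_mono)
  qed
  have e_neg: "e < 0" if "c * int (s + f + 2) < 1000 * int (s + 1)"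
  proof -
    have "of_int (c * int (s + f + 2) - 1000 * int (s + 1)) < (0 :: real)"
      using that by (simp only: of_int_less_0_iff)
    then show ?thesis unfolding int_d e using n by (simp add: divide_neg_pos)
  qed
  have e_pos: "0 < e" if "1000 * int (s + 1) < c * int (s + f + 2)"
  proof -
    have "(0 :: real) < of_int (c * int (s + f + 2) - 1000 * int (s + 1))"
      using that by (simp only: of_int_0_less_iff)
    then show ?thesis unfolding int_d e using n by simp
  qed
  show "of_int c / 1000 < state_index a" if "index_gt c a"
  proof -
    have "e < 0 \<or> (2 * e)\<^sup>2 < v"
      using that cmp e_neg unfolding index_gt_def a fst_conv snd_conv by blast
    then have "2 * e < sqrt v"
      using real_less_rsqrt v by (auto intro: less_le_trans[of _ 0])
    then show ?thesis unfolding idx e_def by simp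
  qed
  show "state_index a < of_int c / 1000" if "index_lt c a"
  proof -
    have "0 < e" "v < (2 * e)\<^sup>2"
      using that cmp' e_pos unfolding index_lt_def a fst_conv snd_conv by blast+
    then have "sqrt v < 2 * e"
      by (intro real_less_lsqrt) auto
    then show ?thesis unfolding idx e_def by simp
  qed
qed

text \<open>
  The data of a period: an integer \<open>c\<close> such that the index of the threshold state \<open>\<tau>\<close> lies between
  \<open>c / 1000\<close> and \<open>(c + 1) / 1000\<close>, while the indices of all other states of positive mass lie outside;
  the threshold state itself, which is the only one that may be pulled partially; the weight that is
  pulled in this state; and pairs of states of which the first one is pulled and the second one is not
  completely pulled.
\<close>
type_synonym period = "int \<times> (nat \<times> nat) \<times> int \<times> ((nat \<times> nat) \<times> (nat \<times> nat)) list"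

definition factorials :: "int list" where
  "factorials = [
    1, 1, 2, 6, 24, 120, 720, 5040, 40320, 362880, 3628800, 39916800, 479001600, 6227020800,
    87178291200, 1307674368000, 20922789888000, 355687428096000, 6402373705728000,
    121645100408832000, 2432902008176640000]"

lemma nth_factorials:
  assumes "n \<le> 20"
  shows "factorials ! n = fact n"
proof -
  have "factorials = map fact [0..<21]"
    by (simp add: factorials_def upt_rec fact_numeral)
  then have "factorials ! n = map fact [0..<21] ! n" by (rule arg_cong)
  also have "\<dots> = fact n" using assms by (subst nth_map_upt) auto
  finally show ?thesis .
qed

text \<open>
  \<open>sequence_prob\<close> multiplied by \<open>fact 20\<close>, which is an integer as long as there are at most 19 outcomes.
\<close>
definition scaled_prob :: "nat \<times> nat \<Rightarrow> int" where
  "scaled_prob a = factorials ! fst a * factorials ! snd a * (factorials ! 20 div factorials ! (fst a + snd a + 1))"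

definition pulled :: "int \<Rightarrow> nat \<times> nat \<Rightarrow> int \<Rightarrow> grid \<Rightarrow> grid" where
  "pulled c \<tau> p = grid_map (\<lambda>a w. if w = 0 then 0 else if a = \<tau> then p else if index_gt (c + 1) a then w else 0)"

text \<open>
  The last conjunct says that one third of all arms is pulled.
\<close>
definition valid :: "int \<Rightarrow> nat \<times> nat \<Rightarrow> int \<Rightarrow> grid \<Rightarrow> grid \<Rightarrow> bool" where
  "valid c \<tau> p W Y \<longleftrightarrow> index_gt c \<tau> \<and> index_lt (c + 1) \<tau> \<and>
     grid_all (\<lambda>a w. w = 0 \<or> 0 \<le> w \<and> fst a + snd a < 20 \<and>
       (if a = \<tau> then 0 \<le> p \<and> p \<le> w else index_gt (c + 1) a \<or> index_lt c a)) W \<and>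
     3 * grid_sum (\<lambda>a w. if w = 0 then 0 else w * scaled_prob a) Y = mass_unit * factorials ! 20"

text \<open>
  The continuation is a parameter so that rewriting computes the grid \<open>Y\<close> once, before it is used in the
  check and in the next grid.
\<close>
definition proceed :: "period \<Rightarrow> grid \<Rightarrow> grid \<Rightarrow> (grid \<Rightarrow> bool) \<Rightarrow> bool" where
  "proceed q W Y continue \<longleftrightarrow> (case q of (c, \<tau>, p, swaps) \<Rightarrow> valid c \<tau> p W Y \<and>
     list_all (\<lambda>(a, b). 0 < cell Y a \<and> cell Y b < cell W b) swaps \<and> continue (grid_next W Y))"

primrec run :: "period list \<Rightarrow> grid \<Rightarrow> bool" where
  "run [] W = True"
| "run (q # ps) W = proceed q W (case q of (c, \<tau>, p, swaps) \<Rightarrow> pulled c \<tau> p W) (run ps)"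

lemma scaled_prob: "fst a + snd a < 20 \<Longrightarrow> of_int (scaled_prob a) = fact 20 * sequence_prob a"
proof -
  assume "fst a + snd a < 20"
  then have "(fact (fst a + snd a + 1) :: int) dvd fact 20"
    by (intro fact_dvd) auto
  then show ?thesis
    using \<open>fst a + snd a < 20\<close>
    unfolding scaled_prob_def sequence_prob_def
    by (simp add: nth_factorials real_of_int_div del: fact_Suc)
qed

lemma profile_of_mono_iff:
  "profile_of G a < profile_of H a \<longleftrightarrow> cell G a < cell H a"
  "profile_of G a \<le> profile_of H a \<longleftrightarrow> cell G a \<le> cell H a"
  "0 < profile_of G a \<longleftrightarrow> 0 < cell G a"
  "0 \<le> profile_of G a \<longleftrightarrow> 0 \<le> cell G a"
  using sequence_prob_pos[of a]
  by (simp_all add: profile_of_def mass_unit_def divide_less_cancel divide_le_cancel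
      zero_less_mult_iff zero_le_mult_iff)

lemma fluid_choice_pulled:
  assumes x: "fluid t (profile_of W)" and v: "valid c \<tau> p W (pulled c \<tau> p W)"
  shows "fluid_choice t (profile_of W) (profile_of (pulled c \<tau> p W))"
proof -
  let ?Y = "pulled c \<tau> p W"
  have Y: "cell ?Y a = (if cell W a = 0 then 0 else if a = \<tau> then p
      else if index_gt (c + 1) a then cell W a else 0)" for a
    unfolding pulled_def by (subst cell_map) auto
  have "grid_all (\<lambda>a w. w = 0 \<or> 0 \<le> w \<and> fst a + snd a < 20 \<and>
       (if a = \<tau> then 0 \<le> p \<and> p \<le> w else index_gt (c + 1) a \<or> index_lt c a)) W"
    using v unfolding valid_def by blast
  from cell_all[OF this] have W: "cell W a = 0 \<or> 0 \<le> cell W a \<and> fst a + snd a < 20 \<and>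
       (if a = \<tau> then 0 \<le> p \<and> p \<le> cell W a else index_gt (c + 1) a \<or> index_lt c a)" for a
    by simp
  have le: "0 \<le> cell ?Y a" "cell ?Y a \<le> cell W a" for a
    using W[of a] by (auto simp: Y split: if_splits)
  have outside: "cell W a = 0" if "a \<notin> states t" for a
    using fluid_outside[OF x that] sequence_prob_pos[of a] by (simp add: profile_of_def mass_unit_def)
  have "3 * (\<Sum>a\<in>states t. profile_of ?Y a) = 1"
  proof -
    have "grid_sum (\<lambda>a w. if w = 0 then 0 else w * scaled_prob a) ?Y
        = (\<Sum>a\<in>states t. if cell ?Y a = 0 then 0 else cell ?Y a * scaled_prob a)"
      using outside by (intro grid_sum_eq) (auto simp: finite_states Y)
    then have "3 * (\<Sum>a\<in>states t. if cell ?Y a = 0 then 0 else cell ?Y a * scaled_prob a) = mass_unit * fact 20"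
      using v by (simp add: valid_def nth_factorials)
    then have "real_of_int (3 * (\<Sum>a\<in>states t. if cell ?Y a = 0 then 0 else cell ?Y a * scaled_prob a))
        = of_int (mass_unit * fact 20)"
      by (rule arg_cong)
    moreover have "real_of_int (\<Sum>a\<in>states t. if cell ?Y a = 0 then 0 else cell ?Y a * scaled_prob a)
        = (\<Sum>a\<in>states t. profile_of ?Y a) * (of_int mass_unit * fact 20)"
    proof -
      have "real_of_int (if cell ?Y a = 0 then 0 else cell ?Y a * scaled_prob a)
          = profile_of ?Y a * (of_int mass_unit * fact 20)" for a
        using W[of a] Y[of a] by (auto simp: profile_of_def scaled_prob mass_unit_def)
      then show ?thesis by (simp only: of_int_sum sum_distrib_right)
    qed
    moreover have "of_int mass_unit * (fact 20 :: real) \<noteq> 0" by (simp add: mass_unit_def)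
    ultimately have "(3 * (\<Sum>a\<in>states t. profile_of ?Y a)) * (of_int mass_unit * fact 20) = 1 * (of_int mass_unit * fact 20)"
      by (simp only: of_int_mult of_int_numeral of_int_fact mult.assoc mult_1)
    with \<open>of_int mass_unit * (fact 20 :: real) \<noteq> 0\<close> show ?thesis
      by (simp only: mult_cancel_right) simp
  qed
  moreover have "state_index b < state_index a" if "0 < cell ?Y a" "cell ?Y b < cell W b" "a \<noteq> b" for a b
  proof -
    have \<tau>: "of_int c / 1000 < state_index \<tau>" "state_index \<tau> < of_int (c + 1) / 1000"
      using v index_tests unfolding valid_def by blast+
    have "a = \<tau> \<or> of_int (c + 1) / 1000 < state_index a"
      using that(1) index_tests(1)[of "c + 1" a] by (auto simp: Y split: if_splits)
    moreover have "b = \<tau> \<or> state_index b < of_int c / 1000"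
      using that(2) W[of b] index_tests(2)[of c b] by (auto simp: Y split: if_splits)
    ultimately show ?thesis using \<tau> \<open>a \<noteq> b\<close> by auto
  qed
  ultimately show ?thesis
    using fluid_outside[OF x] le unfolding fluid_choice_def profile_of_mono_iff by auto
qed

lemma run_sound:
  assumes "run ps W" "fluid t (profile_of W)" "k < length ps" "ps ! k = (c, \<tau>, p, swaps)" "(a, b) \<in> set swaps"
  shows "\<exists>x y. fluid (t + k) x \<and> fluid_choice (t + k) x y \<and> 0 < y a \<and> y b < x b"
  using assms
proof (induction ps arbitrary: W t k)
  case (Cons q ps)
  obtain c' \<tau>' p' swaps' where q: "q = (c', \<tau>', p', swaps')" by (cases q)
  let ?Y = "pulled c' \<tau>' p' W"
  have r: "valid c' \<tau>' p' W ?Y" "list_all (\<lambda>(a, b). 0 < cell ?Y a \<and> cell ?Y b < cell W b) swaps'"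
      "run ps (grid_next W ?Y)"
    using Cons.prems(1) by (simp_all add: q proceed_def)
  have choice: "fluid_choice t (profile_of W) (profile_of ?Y)"
    by (rule fluid_choice_pulled[OF Cons.prems(2) r(1)])
  show ?case
  proof (cases k)
    case 0
    then have "0 < cell ?Y a" "cell ?Y b < cell W b"
      using Cons.prems(4,5) r(2) by (auto simp: q list_all_iff)
    then show ?thesis
      using Cons.prems(2) choice 0 profile_of_mono_iff by (intro exI[of _ "profile_of W"] exI[of _ "profile_of ?Y"]) auto
  next
    case (Suc k')
    have "fluid (Suc t) (profile_of (grid_next W ?Y))"
      using fluid_Suc[OF Cons.prems(2) choice] by (simp add: fluid_next_profile_of)
    then show ?thesis
      using Cons.IH[OF r(3), of "Suc t" k'] Cons.prems(3-5) Suc by simp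
  qed
qed simp

text \<open>
  The weights of the threshold states are determined by the requirement that one third of the arms is
  pulled. The only states inspected for a wrong order are those of periods 15 and 20.
\<close>
definition periods :: "period list" where
  "periods = [
    (644, (0, 0), 295960839779404800000, []),
    (644, (0, 0), 147980419889702400000, []),
    (644, (0, 0), 123317016574752000000, []),
    (644, (0, 0), 86321911602326400000, []),
    (644, (0, 0), 73579153222935360000, []),
    (644, (0, 0), 56109242541512160000, []),
    (644, (0, 0), 48656392690585680000, []),
    (644, (0, 0), 43956154816774200000, []),
    (611, (1, 1), 102092298479923752000, []),
    (611, (1, 1), 170767398204431028000, []),
    (611, (1, 1), 145479319907810288400, []),
    (611, (1, 1), 142541322016411117800, []),
    (611, (1, 1), 128482805404334761380, []),
    (611, (1, 1), 120272665453115625450, []),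
    (605, (6, 5), 27442486600744607876484, [((1, 1), (7, 6))]),
    (594, (2, 2), 419238104048431654140, []),
    (594, (2, 2), 396509476139399339640, []),
    (594, (2, 2), 407784129424119179424, []),
    (594, (2, 2), 376451975662309269117, []),
    (583, (3, 3), 434505241413169192553, [((2, 2), (9, 8))])]"

lemma run_periods: "run periods [[mass_unit]]"
  by code_simp

lemma fluid_periods:
  assumes "k < length periods" "(a, b) \<in> set (snd (snd (snd (periods ! k))))"
  shows "\<exists>x y. fluid k x \<and> fluid_choice k x y \<and> 0 < y a \<and> y b < x b"
proof -
  have "profile_of [[mass_unit]] = (\<lambda>a. of_bool (a = (0, 0)))"
    by (auto simp: fun_eq_iff profile_of_def cell_def nth_default_def sequence_prob_def mass_unit_def)
  then have "fluid 0 (profile_of [[mass_unit]])" by (simp add: fluid_0)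
  from run_sound[OF run_periods this assms(1) _ assms(2)] show ?thesis by (simp add: prod_eq_iff)
qed

text \<open>
  The grid before period \<open>k + 1\<close> has index \<open>k\<close>, so the last periods of the two horizons are found at
  14 and 19.
\<close>
theorem ucb_gap_15_20:
  assumes "T = 15 \<or> T = 20"
  shows "\<exists>c>0. \<forall>\<^sub>F N in sequentially. \<forall>\<pi>. is_ucb N \<pi> \<longrightarrow>
    c * real N \<le> optimal_value T N - policy_value T N \<pi>"
  using assms
proof
  assume T: "T = 15"
  have "\<exists>x y. fluid 14 x \<and> fluid_choice 14 x y \<and> 0 < y (1, 1) \<and> y (7, 6) < x (7, 6)"
    by (rule fluid_periods) (simp_all add: periods_def)
  then obtain x y where "fluid 14 x" "fluid_choice 14 x y" "0 < y (1, 1)" "y (7, 6) < x (7, 6)" by blast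
  from ucb_gap_linear[OF this] show ?thesis by (simp add: T state_mean_def)
next
  assume T: "T = 20"
  have "\<exists>x y. fluid 19 x \<and> fluid_choice 19 x y \<and> 0 < y (2, 2) \<and> y (9, 8) < x (9, 8)"
    by (rule fluid_periods) (simp_all add: periods_def)
  then obtain x y where "fluid 19 x" "fluid_choice 19 x y" "0 < y (2, 2)" "y (9, 8) < x (9, 8)" by blast
  from ucb_gap_linear[OF this] show ?thesis by (simp add: T state_mean_def)
qed

section \<open>The optimality gaps\<close>

theorem proposition2:
  fixes T :: nat
  assumes "T = 15 \<or> T = 20"
  shows "(\<exists>c>0. \<forall>\<^sub>F N in sequentially. \<forall>\<pi>. is_ucb N \<pi> \<longrightarrow>
            optimal_value T N - policy_value T N \<pi> \<ge> c * real N) \<and>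
         (\<exists>c>0. \<forall>\<^sub>F N in sequentially.
            optimal_value T N - policy_value T N (thompson N) \<ge> c * real N)"
proof
  show "\<exists>c>0. \<forall>\<^sub>F N in sequentially. \<forall>\<pi>. is_ucb N \<pi> \<longrightarrow>
      optimal_value T N - policy_value T N \<pi> \<ge> c * real N"
    using ucb_gap_15_20[OF assms] .
  have T: "T = Suc (Suc (T - 2))"
    using assms by auto
  obtain c where "0 < c"
    and "\<And>N. 12 \<le> N \<Longrightarrow> c * real N \<le> optimal_value T N - policy_value T N (thompson N)"
    using thompson_gap_linear[of "T - 2"] unfolding T[symmetric] by blast
  then show "\<exists>c>0. \<forall>\<^sub>F N in sequentially.
      optimal_value T N - policy_value T N (thompson N) \<ge> c * real N"
    by (intro exI[of _ c] conjI eventually_sequentiallyI[of 12]) auto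
qed

end
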